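(* Let $\{x_i\}_{i\ge 1}$, $\{y_j\}_{j\ge 1}$ be real numbers with $x_i,y_j\ge 0$ and $x_iy_j\in[0,1)$ for all $i,j\ge 1$. Let $W=(w_{i,j}:i,j\ge 1)$ be an array of independent random variables with $\mathbb{P}(w_{i,j}=k)=(x_iy_j)^k(1-x_iy_j)$ for $k\in\mathbb{Z}_{\ge 0}$. For $m,n,k\ge 1$ let $G_k(m,n)=g_k(W[m,n])$ be the higher-rank last passage times, where $W[m,n]=(w_{i,j}: 1\le i\le m,\ 1\le j\le n)$, and set $\lambda_1(m,n)=G_1(m,n)$, $\lambda_k(m,n)=G_k(m,n)-G_{k-1}(m,n)$ for $k\ge 2$, and $\lambda(m,n)=(\lambda_k(m,n):k\ge 1)$ (which is a partition). Set $\lambda(m,n)=\emptyset$ when $m=0$ or $n=0$. Fix any integers $M,N\ge 0$ and a down-right path $\gamma=(v_0,\dots,v_{M+N})$ from $v_0=(0,N)$ to $v_{M+N}=(M,0)$, with corresponding word $s_1s_2\cdots s_{M+N}$. Then for any partitions $\lambda^0,\dots,\lambda^{M+N}$, $$\mathbb{P}\big(\lambda(v_i)=\lambda^i \text{ for } i=0,\dots,M+N\big)=Z\cdot \mathbf{1}\{\lambda^0=\lambda^{M+N}=\emptyset\}\cdot\prod_{i=1}^{M+N}Q(\lambda^{i-1},\lambda^i),$$ where $Z=\prod_{(a,b)\in Y(\gamma)}(1-x_ay_b)$ and $$Q(\lambda^{i-1},\lambda^i)=\begin{cases} s_{\lambda^{i-1}/\lambda^i}(y_t), & \text{if } v_{i-1}\in\mathbb{Z}\times\{t\}\text{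 and } s_i=D,\\ s_{\lambda^i/\lambda^{i-1}}(x_t), & \text{if } v_{i-1}\in\{t-1\}\times\mathbb{Z}\text{ and } s_i=R.\end{cases}$$
   Context: Matrices: an $n\times m$ matrix $A=(a_{i,j}:1\le i\le m,\ 1\le j\le n)$ has columns indexed by $i$ (left to right) and rows indexed by $j$ (bottom to top); its entries sit at lattice points $(i,j)\in\mathbb{Z}^2$. Up-right path: a (possibly empty) sequence $\pi=(u_1,\dots,u_r)$ of vertices of $\mathbb{Z}^2$ with $u_i-u_{i-1}\in\{(0,1),(1,0)\}$. Put $A(\pi)=\sum_{v\in\pi}a_v$. For a matrix $A$ with non-negative entries: for $1\le k\le\min(m,n)$, $g_k(A)=\max[A(\pi_1)+\cdots+A(\pi_k)]$, the maximum being over $k$-tuples of pairwise disjoint up-right paths with $\pi_i$ connecting $(1,i)$ to $(m,n-k+i)$; for $k\ge\min(m,n)+1$, $g_k(A)=\sum_{i=1}^m\sum_{j=1}^n a_{i,j}$. (Equivalently, $g_k(A)=h_k(A)$, the maximum of $A(\chi_1)+\cdots+A(\chi_k)$ over $k$-tuples of pairwise disjoint north-east chains in $\{1,\dots,m\}\times\{1,\dots,n\}$, a north-east chain being a possibly empty sequence of points $((a_1,b_1),\dots,(a_r,b_r))$ with $a_{i-1}\le a_i$, $b_{i-1}\le b_i$, $(a_{i-1},b_{i-1})\ne(a_i,b_i)$.) Partition: a weakly decreasing sequence of non-negative integers $\lambda_1\ge\lambda_2\ge\cdots$ that is eventually zero; $\emptyset$ is the zero partition. Interlacing: $\lambda\succeq\mu$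 means $\lambda_1\ge\mu_1\ge\lambda_2\ge\mu_2\ge\cdots$. Skew Schur polynomial in one variable: $s_{\lambda/\mu}(x)=\mathbf{1}\{\lambda\succeq\mu\}\cdot x^{\sum_{i\ge 1}(\lambda_i-\mu_i)}$. Convention: $0^0=1$. Down-right path: a sequence $\gamma=(v_0,\dots,v_r)$ of vertices of $\mathbb{Z}^2$ with $v_i-v_{i-1}\in\{(0,-1),(1,0)\}$. Its corresponding word $s_1\cdots s_r$ has $s_i=D$ if $v_i-v_{i-1}=(0,-1)$ and $s_i=R$ if $v_i-v_{i-1}=(1,0)$. Put $$Y(\gamma)=\{(i,j)\in\mathbb{Z}_{\ge1}^2:(i+d,j+d)\in\gamma\text{ for some integer } d\ge 0\}.$$ *)

theory Defs
  imports "HOL-Probability.Probability"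
begin

text \<open>
  Lattice points are pairs of natural numbers (column, row): every path below joins two points of
  the closed positive quadrant monotonically in each coordinate, so no vertex with a negative
  coordinate can occur. A matrix with m columns and n rows is a function on lattice points of which
  only the values on {1..m} x {1..n} are used.
\<close>

type_synonym vertex = "nat \<times> nat"

definition up_right_path :: "vertex list \<Rightarrow> bool" where
  "up_right_path \<pi> \<longleftrightarrow>
     successively (\<lambda>u v. v = (fst u, snd u + 1) \<or> v = (fst u + 1, snd u)) \<pi>"

definition connects :: "vertex list \<Rightarrow> vertex \<Rightarrow> vertex \<Rightarrow> bool" where
  "connects \<pi> u v \<longleftrightarrow> \<pi> \<noteq> [] \<and> hd \<pi> = u \<and> last \<pi> = v"

definition path_weight :: "(vertex \<Rightarrow> real) \<Rightarrow> vertex list \<Rightarrow> real" where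
  "path_weight A \<pi> = (\<Sum>v\<leftarrow>\<pi>. A v)"

definition disjoint_paths :: "nat \<Rightarrow> nat \<Rightarrow> nat \<Rightarrow> (nat \<Rightarrow> vertex list) \<Rightarrow> bool" where
  "disjoint_paths m n k \<pi> \<longleftrightarrow>
     (\<forall>i\<in>{1..k}. up_right_path (\<pi> i) \<and> connects (\<pi> i) (1, i) (m, n - k + i)) \<and>
     disjoint_family_on (\<lambda>i. set (\<pi> i)) {1..k}"

definition last_passage :: "nat \<Rightarrow> nat \<Rightarrow> (vertex \<Rightarrow> real) \<Rightarrow> nat \<Rightarrow> real" where
  "last_passage m n A k =
     (if k \<le> min m n
      then Max {\<Sum>i=1..k. path_weight A (\<pi> i) | \<pi>. disjoint_paths m n k \<pi>}
      else (\<Sum>i=1..m. \<Sum>j=1..n. A (i, j)))"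

text \<open>
  Sequences that are indexed from 1 in the mathematics are indexed from 0 here: the value at k is
  the (k+1)-st part.
\<close>

definition is_partition :: "(nat \<Rightarrow> nat) \<Rightarrow> bool" where
  "is_partition p \<longleftrightarrow> decseq p \<and> (\<forall>\<^sub>F k in sequentially. p k = 0)"

definition empty_partition :: "nat \<Rightarrow> nat" where
  "empty_partition = (\<lambda>k. 0)"

definition interlaces :: "(nat \<Rightarrow> nat) \<Rightarrow> (nat \<Rightarrow> nat) \<Rightarrow> bool" where
  "interlaces p q \<longleftrightarrow> (\<forall>k. p k \<ge> q k \<and> q k \<ge> p (Suc k))"

text \<open>The subtraction in the exponent does not truncate, because interlacing gives q k <= p k.\<close>

definition skew_schur :: "(nat \<Rightarrow> nat) \<Rightarrow> (nat \<Rightarrow> nat) \<Rightarrow> real \<Rightarrow> real" where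
  "skew_schur p q x = (if interlaces p q then x ^ (\<Sum>k. p k - q k) else 0)"

text \<open>
  The sequence of increments of last passage times of the lower left corner of the array A that
  ends at the given vertex; it is real-valued as defined.
\<close>

definition shape :: "(vertex \<Rightarrow> real) \<Rightarrow> vertex \<Rightarrow> nat \<Rightarrow> real" where
  "shape A v k =
     (let m = fst v; n = snd v in
      if m = 0 \<or> n = 0 then 0
      else if k = 0 then last_passage m n A 1
      else last_passage m n A (k + 1) - last_passage m n A k)"

definition down_right_path :: "vertex list \<Rightarrow> bool" where
  "down_right_path \<gamma> \<longleftrightarrow>
     successively (\<lambda>u v. (fst v, snd v + 1) = u \<or> v = (fst u + 1, snd u)) \<gamma>"

datatype letter = Down | Right

text \<open>The letter of step i of the path (i = 1, ..., r) is the list element at position i - 1.\<close>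

definition path_word :: "vertex list \<Rightarrow> letter list" where
  "path_word \<gamma> = map2 (\<lambda>u v. if (fst v, snd v + 1) = u then Down else Right) \<gamma> (tl \<gamma>)"

definition region :: "vertex list \<Rightarrow> vertex set" where
  "region \<gamma> = {(i, j). i \<ge> 1 \<and> j \<ge> 1 \<and> (\<exists>d. (i + d, j + d) \<in> set \<gamma>)}"

text \<open>The factor Q for a step with letter s that starts at u and leads from p to q.\<close>

definition step_weight ::
    "(nat \<Rightarrow> real) \<Rightarrow> (nat \<Rightarrow> real) \<Rightarrow> vertex \<Rightarrow> letter \<Rightarrow> (nat \<Rightarrow> nat) \<Rightarrow> (nat \<Rightarrow> nat) \<Rightarrow> real" where
  "step_weight x y u s p q =
     (case s of
        Down \<Rightarrow> skew_schur p q (y (snd u))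
      | Right \<Rightarrow> skew_schur q p (x (fst u + 1)))"

end

theory Submission
  imports Defs "Jordan_Normal_Form.Determinant"
begin

text \<open>
  The sequences \<open>\<lambda>(m, n)\<close> obey Fomin's local growth rule: \<open>\<lambda>(m, n)\<close> is
  a function of its three neighbours \<open>\<lambda>(m - 1, n)\<close>, \<open>\<lambda>(m, n - 1)\<close>,
  \<open>\<lambda>(m - 1, n - 1)\<close> and of the entry at \<open>(m, n)\<close> (\<open>local_rule\<close>).
  For fixed \<open>\<nu> = \<lambda>(m - 1, n)\<close> and \<open>\<kappa> = \<lambda>(m, n - 1)\<close> this
  rule is a bijection between pairs \<open>(\<mu>, w)\<close> with \<open>\<mu>\<close> below both
  \<open>\<nu>\<close> and \<open>\<kappa>\<close> and partitions \<open>\<rho>\<close> above both, and it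
  satisfies \<open>|\<rho>| + |\<mu>| = w + |\<nu>| + |\<kappa>|\<close>. With geometric entries the weight
  \<open>(x y)^w (1 - x y)\<close> of the entry is therefore exactly what turns the two Schur factors around
  \<open>\<mu>\<close> into the two around \<open>\<rho>\<close> (\<open>skew_schur_flip\<close>). Replacing a
  right-down corner of the path by the opposite corner of its unit square removes one independent entry, so the
  formula follows by induction over corner flips (\<open>growth_law\<close>); a path without such a corner runs
  along the axes, where all shapes are empty.

  The substance is that last passage times over disjoint paths satisfy the local rule. Summed over the parts,
  the rule is the identity \<open>G_k(m, n) + G_{k-1}(m-1, n-1) = w + max (G_k(m-1, n) + G_{k-1}(m, n-1))
  (G_{k-1}(m-1, n) + G_k(m, n-1))\<close> (\<open>passage_recurrence\<close>), a three-term Pluecker relation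
  with sums and products replaced by maxima and sums. It is obtained from the genuine relation as follows. Give
  an entry \<open>a\<close> the weight \<open>q^a\<close> and let \<open>path_poly A c r i\<close> be the
  generating polynomial in \<open>q\<close> of the paths to \<open>(c, r)\<close> from the \<open>i\<close>-th
  starting point. Minors of this matrix generate families of disjoint paths: building the families one vertex at
  a time corresponds to adding a multiple of one row of the matrix to the next, which changes a minor by a
  multiple of a single other minor. Hence minors are zero or have positive leading coefficient, and their degree
  is the maximal weight of a family (\<open>minor_records_max\<close>). Since the polynomials involved are not
  negative, degrees turn a product into a sum and a sum into a maximum, and the Pluecker relation between minors
  (\<open>corner_minor_three_term\<close>) becomes the identity between last passage times.
\<close>

section \<open>Determinants of lists of rows\<close>

text \<open>
  Rows are functions on all of \<open>nat\<close>, so that lists of different lengths, whose determinants have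
  different sizes, can share their rows: the minor with rows \<open>S\<close> in the first \<open>length
  S\<close> columns of a matrix \<open>M\<close> is \<open>rdet (map M S)\<close>.
\<close>

definition rdet :: "(nat \<Rightarrow> 'a::comm_ring_1) list \<Rightarrow> 'a" where
  "rdet vs = det (mat (length vs) (length vs) (\<lambda>(i, j). (vs ! i) j))"

lemma rdet_Nil [simp]: "rdet [] = 1"
  by (simp add: rdet_def)

lemma rdet_cong:
  assumes "length us = length vs"
    and "\<And>i j. i < length vs \<Longrightarrow> j < length vs \<Longrightarrow> (us ! i) j = (vs ! i) j"
  shows "rdet us = rdet vs"
  unfolding rdet_def using assms by (intro arg_cong[where f = det] eq_matI) auto

lemma rdet_scale_rows:
  "rdet (map (\<lambda>r j. f r * v r j) S) = (\<Prod>r\<leftarrow>S. f r) * rdet (map v S)"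
proof -
  let ?n = "length S"
  have perm: "p i < ?n" if "p permutes {0..<?n}" "i < ?n" for p i
    using permutes_in_image[OF that(1), of i] that(2) by simp
  have "rdet (map (\<lambda>r j. f r * v r j) S) =
      (\<Sum>p\<in>{p. p permutes {0..<?n}}. signof p * (\<Prod>i = 0..<?n. f (S ! i) * v (S ! i) (p i)))"
    unfolding rdet_def by (subst det_def'[of _ ?n]) (auto intro!: sum.cong prod.cong simp: perm)
  also have "\<dots> = (\<Sum>p\<in>{p. p permutes {0..<?n}}. (\<Prod>i = 0..<?n. f (S ! i)) *
      (signof p * (\<Prod>i = 0..<?n. v (S ! i) (p i))))"
    by (intro sum.cong refl) (simp add: prod.distrib algebra_simps)
  also have "\<dots> = (\<Prod>i = 0..<?n. f (S ! i)) * rdet (map v S)"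
    unfolding rdet_def
    by (subst det_def'[of _ ?n])
      (auto simp: sum_distrib_left perm intro!: sum.cong prod.cong)
  also have "(\<Prod>i = 0..<?n. f (S ! i)) = (\<Prod>r\<leftarrow>S. f r)"
    by (simp add: prod.list_conv_set_nth)
  finally show ?thesis .
qed

lemma rdet_equal_rows:
  assumes "i < length vs" "j < length vs" "i \<noteq> j" "vs ! i = vs ! j"
  shows "rdet vs = 0"
  unfolding rdet_def
  by (rule det_identical_rows[of _ "length vs" i j]) (use assms in \<open>auto intro!: eq_vecI\<close>)

text \<open>
  The cofactors of row \<open>i\<close> do not depend on that row, which makes \<open>rdet\<close> an explicit
  linear function of each row.
\<close>

definition rcof :: "(nat \<Rightarrow> 'a::comm_ring_1) list \<Rightarrow> nat \<Rightarrow> nat \<Rightarrow> 'a" where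
  "rcof vs i j = cofactor (mat (length vs) (length vs) (\<lambda>(i, j). (vs ! i) j)) i j"

lemma rdet_update:
  assumes "i < length vs"
  shows "rdet (vs[i := u]) = (\<Sum>j<length vs. u j * rcof vs i j)"
proof -
  let ?n = "length vs"
  let ?A = "mat ?n ?n (\<lambda>(k, j). (vs[i := u] ! k) j)"
  have "rdet (vs[i := u]) = (\<Sum>j<?n. ?A $$ (i, j) * cofactor ?A i j)"
    unfolding rdet_def length_list_update
    by (rule laplace_expansion_row) (use assms in auto)
  also have "\<dots> = (\<Sum>j<?n. u j * rcof vs i j)"
  proof (intro sum.cong refl, goal_cases)
    case (1 j)
    have "mat_delete ?A i j = mat_delete (mat ?n ?n (\<lambda>(i, j). (vs ! i) j)) i j"
      unfolding mat_delete_def by (intro eq_matI) auto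
    then show ?case using 1 assms by (simp add: rcof_def cofactor_def)
  qed
  finally show ?thesis .
qed

lemma rdet_row_linear:
  assumes "i < length vs"
  shows "rdet (vs[i := (\<lambda>j. u j + c * v j)]) = rdet (vs[i := u]) + c * rdet (vs[i := v])"
  using assms
  by (simp add: rdet_update sum.distrib sum_distrib_left algebra_simps)

lemma rdet_zero_row:
  assumes "i < length vs" "\<And>j. j < length vs \<Longrightarrow> (vs ! i) j = 0"
  shows "rdet vs = 0"
proof -
  have "rdet (vs[i := vs ! i]) = 0"
    using assms by (subst rdet_update) auto
  then show ?thesis by simp
qed

text \<open>
  Every vector is a combination of the rows, with coefficients given by Cramer's rule. This is the identity
  \<open>adj B * B = det B\<close>, multiplied by the row vector \<open>c\<close> from the left.
\<close>

lemma cramer_rows: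
  assumes "j < length vs"
  shows "rdet vs * c j = (\<Sum>i<length vs. rdet (vs[i := c]) * (vs ! i) j)"
proof -
  let ?n = "length vs"
  let ?A = "mat ?n ?n (\<lambda>(i, j). (vs ! i) j)"
  have adj: "(\<Sum>i<?n. rcof vs i k * (vs ! i) j) = (if k = j then rdet vs else 0)" if "k < ?n" for k
  proof -
    have "(adj_mat ?A * ?A) $$ (k, j) = (det ?A \<cdot>\<^sub>m 1\<^sub>m ?n) $$ (k, j)"
      by (subst adj_mat(3)) auto
    then show ?thesis
      using that assms
      by (simp add: adj_mat_def scalar_prod_def rcof_def rdet_def lessThan_atLeast0 cong: if_cong)
  qed
  have "(\<Sum>i<?n. rdet (vs[i := c]) * (vs ! i) j) = (\<Sum>i<?n. \<Sum>k<?n. c k * (rcof vs i k * (vs ! i) j))"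
    by (intro sum.cong refl) (simp add: rdet_update sum_distrib_right mult.assoc)
  also have "\<dots> = (\<Sum>k<?n. c k * (\<Sum>i<?n. rcof vs i k * (vs ! i) j))"
    by (subst sum.swap) (simp add: sum_distrib_left)
  also have "\<dots> = (\<Sum>k<?n. if k = j then c k * rdet vs else 0)"
    by (intro sum.cong refl) (simp add: adj)
  also have "\<dots> = rdet vs * c j" using assms by (simp add: mult.commute)
  finally show ?thesis by simp
qed

text \<open>
  Apply the functional \<open>u \<mapsto> rdet (u # T @ [d])\<close> to the expansion of \<open>c\<close> in the
  rows \<open>a, T, b\<close> given by Cramer's rule. It vanishes on all rows in \<open>T\<close>, so only the
  terms of \<open>a\<close> and \<open>b\<close> survive.
\<close>

lemma rdet_exchange:
  "rdet (a # T @ [b]) * rdet (c # T @ [d]) =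
     rdet (c # T @ [b]) * rdet (a # T @ [d]) + rdet (a # T @ [c]) * rdet (b # T @ [d])"
proof -
  define B where "B = a # T @ [b]"
  define \<phi> where "\<phi> = (\<lambda>u. rdet (u # T @ [d]))"
  let ?n = "length T + 2"
  let ?C = "rcof (a # T @ [d]) 0"
  have len: "length B = ?n" by (simp add: B_def)
  have \<phi>: "\<phi> u = (\<Sum>j<?n. u j * ?C j)" for u
    using rdet_update[of 0 "a # T @ [d]" u] by (simp add: \<phi>_def)
  have "rdet B * \<phi> c = (\<Sum>j<?n. (rdet B * c j) * ?C j)"
    by (simp add: \<phi> sum_distrib_left mult.assoc del: sum.lessThan_Suc)
  also have "\<dots> = (\<Sum>j<?n. (\<Sum>i<?n. rdet (B[i := c]) * (B ! i) j) * ?C j)"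
    by (intro sum.cong refl) (use cramer_rows[of _ B c] len in auto)
  also have "\<dots> = (\<Sum>i<?n. rdet (B[i := c]) * \<phi> (B ! i))"
    unfolding \<phi> sum_distrib_left sum_distrib_right
    by (subst sum.swap) (simp add: mult.assoc)
  also have "\<dots> = (\<Sum>i\<in>{0, Suc (length T)}. rdet (B[i := c]) * \<phi> (B ! i))"
  proof (intro sum.mono_neutral_right ballI, goal_cases)
    case (3 i)
    then obtain k where k: "i = Suc k" "k < length T" by (cases i) auto
    have "\<phi> (B ! i) = 0"
      unfolding \<phi>_def
      by (rule rdet_equal_rows[of 0 _ i]) (use k in \<open>auto simp: B_def nth_append\<close>)
    then show ?case by simp
  qed auto
  also have "\<dots> = rdet (c # T @ [b]) * \<phi> a + rdet (a # T @ [c]) * \<phi> b"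
    by (simp add: B_def list_update_append)
  finally show ?thesis by (simp add: B_def \<phi>_def)
qed

lemma rdet_swap:
  "rdet (xs @ u # v # ys) = - rdet (xs @ v # u # ys)"
proof -
  let ?p = "length xs"
  let ?s = "\<lambda>j. u j + 1 * v j"
  have l: "(xs @ a # b # ys)[?p := c] = xs @ c # b # ys" 
    "(xs @ a # b # ys)[Suc ?p := c] = xs @ a # c # ys" for a b c :: "nat \<Rightarrow> 'a"
    by (simp_all add: list_update_append)
  have z: "rdet (xs @ a # a # ys) = 0" for a
    by (rule rdet_equal_rows[of ?p _ "Suc ?p"]) (auto simp: nth_append)
  have 1: "rdet (xs @ ?s # b # ys) = rdet (xs @ u # b # ys) + rdet (xs @ v # b # ys)" for b
    using rdet_row_linear[of ?p "xs @ u # b # ys" u 1 v] by (simp add: l)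
  have 2: "rdet (xs @ a # ?s # ys) = rdet (xs @ a # u # ys) + rdet (xs @ a # v # ys)" for a
    using rdet_row_linear[of "Suc ?p" "xs @ a # u # ys" u 1 v] by (simp add: l)
  have "rdet (xs @ u # v # ys) + rdet (xs @ v # u # ys) = 0"
    using 1[of ?s] 2[of u] 2[of v] z[of ?s] z[of u] z[of v] by simp
  then show ?thesis by (simp add: eq_neg_iff_add_eq_0)
qed

lemma rdet_rotate:
  "rdet (xs @ T @ u # ys) = (-1) ^ length T * rdet (xs @ u # T @ ys)"
proof (induction T arbitrary: xs)
  case (Cons t T)
  show ?case using Cons[of "xs @ [t]"] rdet_swap[of xs t u "T @ ys"] by simp
qed simp

text \<open>
  A final unit row reduces the size of a determinant by one. In this way relations between minors of two
  consecutive sizes are special cases of relations between minors of one size.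
\<close>

lemma rdet_last_unit:
  "rdet (vs @ [\<lambda>j. if j = length vs then 1 else 0]) = rdet vs"
proof -
  let ?n = "length vs"
  let ?e = "\<lambda>j. if j = length vs then 1 else 0 :: 'a"
  let ?ws = "vs @ [?e]"
  have "rdet ?ws = (\<Sum>j<Suc ?n. ?e j * rcof ?ws ?n j)"
    using rdet_update[of ?n ?ws ?e] by (simp del: sum.lessThan_Suc)
  also have "\<dots> = rcof ?ws ?n ?n" by simp
  also have "\<dots> = rdet vs"
    unfolding rcof_def cofactor_def rdet_def
    by (simp add: mat_delete_def) (intro arg_cong[where f = det] eq_matI; auto simp: nth_append)
  finally show ?thesis .
qed

text \<open>
  The incidence Pluecker relation between minors of sizes \<open>length T + 2\<close> and \<open>length T +
  1\<close>: the exchange relation with the last unit vector in place of \<open>d\<close>. Two reorderings of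
  the rows contribute the same sign, so no signs remain.
\<close>

lemma rdet_plucker:
  "rdet (a # T @ [b]) * rdet (c # T) = rdet (c # T @ [b]) * rdet (a # T) + rdet (a # c # T) * rdet (T @ [b])"
proof -
  let ?e = "\<lambda>j. if j = Suc (length T) then 1 else 0 :: 'a"
  have e: "rdet (u # T @ [?e]) = rdet (u # T)" for u
    using rdet_last_unit[of "u # T"] by simp
  have "rdet (a # T @ [c]) = (-1) ^ length T * rdet (a # c # T)"
    using rdet_rotate[of "[a]" T c "[]"] by simp
  moreover have "rdet (T @ [b]) = (-1) ^ length T * rdet (b # T)"
    using rdet_rotate[of "[]" T b "[]"] by simp
  moreover have "(-1) ^ length T * (-1) ^ length T = (1::'a)"
    by (simp add: power_add[symmetric])
  ultimately have "rdet (a # T @ [c]) * rdet (b # T) = rdet (a # c # T) * rdet (T @ [b])"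
    by (simp add: mult.assoc mult.left_commute)
  then show ?thesis using rdet_exchange[of a T b c ?e] by (simp add: e)
qed

section \<open>Generating polynomials of paths\<close>

text \<open>
  The generating polynomial of the up-right paths from \<open>(1, i + 1)\<close> to \<open>(c, r)\<close>, where
  a path has weight \<open>q\<close> to the sum of its entries. Column 0 carries a virtual starting point
  \<open>(0, i + 1)\<close> of weight one, from which the path steps to the right into its true starting point.
\<close>

fun path_poly :: "(vertex \<Rightarrow> nat) \<Rightarrow> nat \<Rightarrow> nat \<Rightarrow> nat \<Rightarrow> int poly" where
  "path_poly A 0 r i = (if r = Suc i then 1 else 0)"
| "path_poly A (Suc c) 0 i = 0"
| "path_poly A (Suc c) (Suc r) i =
     monom 1 (A (Suc c, Suc r)) * (path_poly A c (Suc r) i + path_poly A (Suc c) r i)"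

lemma path_poly_row_0 [simp]: "path_poly A c 0 i = 0"
  by (cases c) auto

text \<open>
  An intermediate stage between columns \<open>c - 1\<close> and \<open>c\<close>: the row of \<open>r\<close>
  generates the paths to \<open>(c, r)\<close> whose vertical steps within column \<open>c\<close> end in a row
  \<open>\<le> j\<close>. A path that ends above row \<open>j\<close> must enter column \<open>c\<close>
  horizontally.
\<close>

definition state_row :: "(vertex \<Rightarrow> nat) \<Rightarrow> nat \<Rightarrow> nat \<Rightarrow> nat \<Rightarrow> nat \<Rightarrow> int poly" where
  "state_row A c j r =
     (if r \<le> j then path_poly A c r else (\<lambda>i. monom 1 (A (c, r)) * path_poly A (c - 1) r i))"

definition minor :: "(vertex \<Rightarrow> nat) \<Rightarrow> nat \<Rightarrow> nat \<Rightarrow> nat list \<Rightarrow> int poly" where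
  "minor A c j S = rdet (map (state_row A c j) S)"

lemma minor_step_notin:
  assumes "Suc j \<notin> set S"
  shows "minor A c (Suc j) S = minor A c j S"
proof -
  have "map (state_row A c (Suc j)) S = map (state_row A c j) S"
    using assms by (auto simp: state_row_def le_Suc_eq)
  then show ?thesis by (simp only: minor_def)
qed

text \<open>
  Passing from stage \<open>j\<close> to stage \<open>j + 1\<close> adds a multiple of row \<open>j\<close> to
  row \<open>j + 1\<close> and leaves the other rows unchanged.
\<close>

lemma minor_step:
  assumes "c \<ge> 1" "distinct S" "p < length S" "S ! p = Suc j"
  shows "minor A c (Suc j) S = minor A c j S + monom 1 (A (c, Suc j)) * minor A c j (S[p := j])"
proof -
  obtain d where c: "c = Suc d" using assms(1) by (cases c) auto
  let ?w = "monom 1 (A (c, Suc j)) :: int poly"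
  let ?vs = "map (state_row A c j) S"
  have upd: "map (state_row A c (Suc j)) S =
      ?vs[p := (\<lambda>i. state_row A c j (Suc j) i + ?w * state_row A c j j i)]"
  proof (rule nth_equalityI)
    fix i assume i: "i < length (map (state_row A c (Suc j)) S)"
    show "map (state_row A c (Suc j)) S ! i =
        ?vs[p := (\<lambda>i. state_row A c j (Suc j) i + ?w * state_row A c j j i)] ! i"
    proof (cases "i = p")
      case True
      then show ?thesis using i assms(4) c
        by (auto simp: state_row_def fun_eq_iff algebra_simps)
    next
      case False
      then have "S ! i \<noteq> Suc j"
        using assms i nth_eq_iff_index_eq[of S i p] by auto
      then show ?thesis using i False
        by (auto simp: state_row_def le_Suc_eq)
    qed
  qed auto
  have "?vs[p := state_row A c j (Suc j)] = ?vs"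
    using assms by (metis list_update_id nth_map)
  moreover have "?vs[p := state_row A c j j] = map (state_row A c j) (S[p := j])"
    by (simp add: map_update)
  ultimately show ?thesis
    unfolding minor_def upd using assms(3) by (subst rdet_row_linear) auto
qed

lemma minor_repeated:
  assumes "p < length S" "q < length S" "p \<noteq> q" "S ! p = S ! q"
  shows "minor A c j S = 0"
  unfolding minor_def by (rule rdet_equal_rows[of p _ q]) (use assms in auto)

lemma minor_next_column:
  assumes "\<forall>s\<in>set S. s \<le> J"
  shows "minor A (Suc c) 0 S = (\<Prod>s\<leftarrow>S. monom 1 (A (Suc c, s))) * minor A c J S"
proof -
  have "map (state_row A (Suc c) 0) S =
      map (\<lambda>r i. monom 1 (A (Suc c, r)) * state_row A c J r i) S"
    using assms by (auto simp: state_row_def fun_eq_iff)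
  then show ?thesis
    by (simp only: minor_def rdet_scale_rows)
qed

section \<open>Polynomials that record a maximum by their degree\<close>

text \<open>
  The polynomial \<open>p\<close> determines the maximum of the set \<open>V\<close> of weights. The order on
  polynomials is that of their leading coefficients, so there is no cancellation of leading terms in sums. The
  zero polynomial stands for the maximum \<open>-\<infinity>\<close> of the empty set.
\<close>

definition records_max :: "int poly \<Rightarrow> nat set \<Rightarrow> bool" where
  "records_max p V \<longleftrightarrow>
     p = 0 \<and> V = {} \<or> 0 < p \<and> degree p \<in> V \<and> (\<forall>v\<in>V. v \<le> degree p)"

lemma degree_add_pos:
  fixes p q :: "int poly"
  assumes "0 < p" "0 < q"
  shows "degree (p + q) = max (degree p) (degree q)"
proof -
  have "coeff (p + q) (max (degree p) (degree q)) > 0"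
    using assms coeff_eq_0[of p "degree q"] coeff_eq_0[of q "degree p"]
    by (cases "degree p" "degree q" rule: linorder_cases)
      (auto simp: less_poly_def pos_poly_def max_def)
  then show ?thesis
    using degree_add_le_max[of p q] le_degree[of "p + q" "max (degree p) (degree q)"]
    by (intro antisym) auto
qed

lemma records_max_add:
  assumes "records_max p V" "records_max q U"
  shows "records_max (p + q) (V \<union> U)"
  using assms unfolding records_max_def
  by (cases "degree p \<le> degree q")
    (auto simp: degree_add_pos max_def add_pos_pos intro: order_trans less_imp_le)

lemma monom_pos: "0 < (monom 1 a :: int poly)"
  by (simp add: less_poly_def pos_poly_def degree_monom_eq)

lemma records_max_monom_mult:
  assumes "records_max p V"
  shows "records_max (monom 1 a * p) ((+) a ` V)"
  using assms monom_pos[of a] unfolding records_max_def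
  by (auto simp: degree_mult_eq degree_monom_eq)

lemma prod_list_monom: "(\<Prod>s\<leftarrow>S. monom 1 (f s)) = (monom 1 (\<Sum>s\<leftarrow>S. f s) :: int poly)"
  by (induction S) (auto simp: mult_monom one_pCons monom_0)

section \<open>Families of disjoint paths, built one vertex at a time\<close>

lemma up_right_path_bounds:
  assumes "up_right_path p" "u \<in> set p"
  shows "fst (hd p) \<le> fst u" "snd (hd p) \<le> snd u" "fst u \<le> fst (last p)" "snd u \<le> snd (last p)"
proof -
  have "fst (hd p) \<le> fst u \<and> snd (hd p) \<le> snd u \<and> fst u \<le> fst (last p) \<and> snd u \<le> snd (last p)"
    using assms
  proof (induction p arbitrary: u rule: induct_list012)
    case (3 x y zs)
    have r: "up_right_path (y # zs)" "fst x \<le> fst y \<and> snd x \<le> snd y"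
      using 3(3) by (auto simp: up_right_path_def)
    have y: "fst y \<le> fst (last (y # zs)) \<and> snd y \<le> snd (last (y # zs))"
      using 3(2)[OF r(1), of y] by simp
    show ?case
    proof (cases "u = x")
      case True
      then show ?thesis using y r(2) by auto
    next
      case False
      then show ?thesis using 3(2)[OF r(1), of u] 3(4) r(2) by auto
    qed
  qed auto
  then show "fst (hd p) \<le> fst u" "snd (hd p) \<le> snd u" "fst u \<le> fst (last p)" "snd u \<le> snd (last p)"
    by auto
qed

text \<open>
  These are the paths generated by \<open>state_row\<close> at stage \<open>j\<close> of column
  \<open>c\<close>.
\<close>

definition limited_path :: "nat \<Rightarrow> nat \<Rightarrow> vertex list \<Rightarrow> bool" where
  "limited_path c j p \<longleftrightarrow>
     successively (\<lambda>u v. v = (fst u, snd u + 1) \<and> (fst v = c \<longrightarrow> snd v \<le> j) \<or> v = (fst u + 1, snd u)) p"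

lemma limited_path_imp_up_right: "limited_path c j p \<Longrightarrow> up_right_path p"
  unfolding limited_path_def up_right_path_def by (erule successively_mono) auto

lemma limited_path_mono: "limited_path c j p \<Longrightarrow> j \<le> j' \<Longrightarrow> limited_path c j' p"
  unfolding limited_path_def by (erule successively_mono) auto

lemma limited_path_cong:
  assumes "\<And>v. v \<in> set p \<Longrightarrow> (fst v = c \<longrightarrow> snd v \<le> j) \<longleftrightarrow> (fst v = c' \<longrightarrow> snd v \<le> j')"
  shows "limited_path c j p \<longleftrightarrow> limited_path c' j' p"
  unfolding limited_path_def using assms by (intro successively_cong refl) auto

lemma limited_path_unrestricted:
  assumes "\<And>v. v \<in> set p \<Longrightarrow> fst v = c \<Longrightarrow> snd v \<le> j"
  shows "limited_path c j p \<longleftrightarrow> up_right_path p"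
  unfolding limited_path_def up_right_path_def using assms by (intro successively_cong refl) auto

lemma limited_path_snoc:
  "limited_path c j (p @ [v]) \<longleftrightarrow> limited_path c j p \<and>
     (p = [] \<or> v = (fst (last p), snd (last p) + 1) \<and> (fst v = c \<longrightarrow> snd v \<le> j) \<or>
      v = (fst (last p) + 1, snd (last p)))"
  by (auto simp: limited_path_def successively_append_iff)

text \<open>
  In row \<open>j\<close> or higher of column \<open>c\<close> a limited path can only continue to the right. If
  it ends in column \<open>c\<close> it must stop there.
\<close>

lemma limited_path_top:
  assumes "limited_path c j p" "fst (last p) = c" "v \<in> set p" "fst v = c" "j \<le> snd v"
  shows "v = last p"
  using assms
proof (induction p rule: induct_list012)
  case (3 x y zs)
  have y: "limited_path c j (y # zs)" 
    "y = (fst x, snd x + 1) \<and> (fst y = c \<longrightarrow> snd y \<le> j) \<or> y = (fst x + 1, snd x)"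
    using 3(3) by (auto simp: limited_path_def)
  have "fst y \<le> c"
    using up_right_path_bounds(3)[OF limited_path_imp_up_right[OF y(1)], of y] 3(4) by simp
  then have "v \<noteq> x" using y(2) 3(6,7) by auto
  then show ?case using 3(2)[OF y(1)] 3(4-7) by auto
qed auto

text \<open>
  The endpoints in column \<open>c\<close> are listed from bottom to top in \<open>S\<close>; indices of paths
  are shifted to start from 0.
\<close>

definition family :: "nat \<Rightarrow> nat \<Rightarrow> nat list \<Rightarrow> (nat \<Rightarrow> vertex list) \<Rightarrow> bool" where
  "family c j S \<pi> \<longleftrightarrow>
     (\<forall>i<length S. limited_path c j (\<pi> i) \<and> connects (\<pi> i) (1, Suc i) (c, S ! i)) \<and>
     disjoint_family_on (\<lambda>i. set (\<pi> i)) {..<length S}"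

definition family_weight :: "(vertex \<Rightarrow> nat) \<Rightarrow> nat list \<Rightarrow> (nat \<Rightarrow> vertex list) \<Rightarrow> nat" where
  "family_weight A S \<pi> = (\<Sum>i<length S. \<Sum>v\<leftarrow>\<pi> i. A v)"

definition weights :: "(vertex \<Rightarrow> nat) \<Rightarrow> nat \<Rightarrow> nat \<Rightarrow> nat list \<Rightarrow> nat set" where
  "weights A c j S = family_weight A S ` {\<pi>. family c j S \<pi>}"

lemma family_disjoint:
  assumes "family c j S \<pi>" "i < length S" "k < length S" "v \<in> set (\<pi> i)" "v \<in> set (\<pi> k)"
  shows "i = k"
  using assms unfolding family_def disjoint_family_on_def by blast

lemma familyD:
  assumes "family c j S \<pi>" "i < length S"
  shows "limited_path c j (\<pi> i)" "\<pi> i \<noteq> []" "hd (\<pi> i) = (1, Suc i)" "last (\<pi> i) = (c, S ! i)"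
  using assms unfolding family_def connects_def by auto

lemma family_step_notin:
  assumes "Suc j \<notin> set S"
  shows "family c (Suc j) S \<pi> \<longleftrightarrow> family c j S \<pi>"
proof
  assume f: "family c (Suc j) S \<pi>"
  have "limited_path c j (\<pi> i)" if i: "i < length S" for i
  proof -
    have "(c, Suc j) \<notin> set (\<pi> i)"
      using limited_path_top[of c "Suc j" "\<pi> i" "(c, Suc j)"] familyD[OF f i] assms nth_mem[OF i]
      by auto
    then have "limited_path c j (\<pi> i) \<longleftrightarrow> limited_path c (Suc j) (\<pi> i)"
      by (intro limited_path_cong) (auto simp: le_Suc_eq)
    then show ?thesis using familyD[OF f i] by simp
  qed
  then show "family c j S \<pi>" using f by (auto simp: family_def)
next
  assume "family c j S \<pi>"
  then show "family c (Suc j) S \<pi>" unfolding family_def using limited_path_mono le_SucI le_refl by blast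
qed

lemma family_mono: "family c j S \<pi> \<Longrightarrow> family c (Suc j) S \<pi>"
  unfolding family_def using limited_path_mono le_SucI le_refl by blast

lemma family_step_extend:
  assumes f: "family c j (S[p := j]) \<pi>" and p: "p < length S" "S ! p = Suc j" and d: "distinct S"
  shows "family c (Suc j) S (\<pi>(p := \<pi> p @ [(c, Suc j)]))"
proof -
  note D = familyD[OF f, unfolded length_list_update]
  have new: "(c, Suc j) \<notin> set (\<pi> i)" if i: "i < length S" for i
  proof
    assume "(c, Suc j) \<in> set (\<pi> i)"
    then have "S[p := j] ! i = Suc j"
      using limited_path_top[of c j "\<pi> i" "(c, Suc j)"] D[OF i] by auto
    then show False using p d i nth_eq_iff_index_eq[of S i p] by (cases "i = p") auto
  qed
  have "limited_path c (Suc j) (\<pi> p @ [(c, Suc j)])"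
    using D[OF p(1)] p limited_path_mono[of c j "\<pi> p" "Suc j"] by (auto simp: limited_path_snoc)
  moreover have "connects (\<pi> p @ [(c, Suc j)]) (1, Suc p) (c, S ! p)"
    using D[OF p(1)] p by (auto simp: connects_def)
  moreover have "limited_path c (Suc j) (\<pi> i) \<and> connects (\<pi> i) (1, Suc i) (c, S ! i)"
    if "i < length S" "i \<noteq> p" for i
    using D[OF that(1)] that limited_path_mono[of c j "\<pi> i" "Suc j"] by (auto simp: connects_def)
  moreover have "disjoint_family_on (\<lambda>i. set ((\<pi>(p := \<pi> p @ [(c, Suc j)])) i)) {..<length S}"
    unfolding disjoint_family_on_def
  proof (intro ballI impI)
    fix i k assume ik: "i \<in> {..<length S}" "k \<in> {..<length S}" "i \<noteq> k"
    then have "set (\<pi> i) \<inter> set (\<pi> k) = {}"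
      using family_disjoint[OF f, unfolded length_list_update] by blast
    then show "set ((\<pi>(p := \<pi> p @ [(c, Suc j)])) i) \<inter> set ((\<pi>(p := \<pi> p @ [(c, Suc j)])) k) = {}"
      using new[of i] new[of k] ik by auto
  qed
  ultimately show ?thesis by (auto simp: family_def)
qed

text \<open>
  Only the path that ends in \<open>(c, j + 1)\<close> can use the vertical step admitted at stage \<open>j +
  1\<close>, and only as its last step. Removing that step gives a family for the previous stage. The shortened
  path ends at \<open>(c, j)\<close>, which by disjointness is not the endpoint of another path.
\<close>

lemma family_step_cases:
  assumes f: "family c (Suc j) S \<pi>" and p: "p < length S" "S ! p = Suc j" and d: "distinct S"
  shows "family c j S \<pi> \<or>
    j \<notin> set S \<and> (\<exists>\<pi>'. family c j (S[p := j]) \<pi>' \<and> \<pi> = \<pi>'(p := \<pi>' p @ [(c, Suc j)]))"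
proof -
  note D = familyD[OF f]
  have lower: "limited_path c j q" if "limited_path c (Suc j) q" "(c, Suc j) \<notin> set q" for q
  proof -
    have "limited_path c j q \<longleftrightarrow> limited_path c (Suc j) q"
      using that by (intro limited_path_cong) (auto simp: le_Suc_eq)
    then show ?thesis using that by simp
  qed
  have other: "limited_path c j (\<pi> i)" if i: "i < length S" "i \<noteq> p" for i
  proof (rule lower)
    show "(c, Suc j) \<notin> set (\<pi> i)"
    proof
      assume "(c, Suc j) \<in> set (\<pi> i)"
      then have "S ! i = Suc j"
        using limited_path_top[of c "Suc j" "\<pi> i" "(c, Suc j)"] D[OF i(1)] by auto
      then show False using p d i nth_eq_iff_index_eq[of S i p] by auto
    qed
  qed (use D[OF i(1)] in auto)
  define q where "q = butlast (\<pi> p)"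
  have q: "\<pi> p = q @ [(c, Suc j)]"
    unfolding q_def using D[OF p(1)] p(2) by (metis append_butlast_last_id)
  have lq: "limited_path c (Suc j) q"
    and cs: "q = [] \<or> last q = (c, j) \<or> (c = Suc (fst (last q)) \<and> snd (last q) = Suc j)"
    using D(1)[OF p(1)] unfolding q limited_path_snoc by (auto simp: prod_eq_iff)
  \<comment> \<open>The last vertex of \<open>q\<close> lies to the left of or below \<open>(c, Suc j)\<close>, which bounds all of \<open>q\<close>.\<close>
  have fresh: "(c, Suc j) \<notin> set q"
    using up_right_path_bounds[OF limited_path_imp_up_right[OF lq], of "(c, Suc j)"] cs by auto
  have jq: "limited_path c j q" by (rule lower[OF lq fresh])
  show ?thesis
  proof (cases "q \<noteq> [] \<and> last q = (c, j)")
    case True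
    then have mem: "(c, j) \<in> set (\<pi> p)" using q last_in_set[of q] by auto
    have "j \<notin> set S"
    proof
      assume "j \<in> set S"
      then obtain i where i: "i < length S" "S ! i = j" by (auto simp: in_set_conv_nth)
      then have "(c, j) \<in> set (\<pi> i)" using D[OF i(1)] last_in_set[of "\<pi> i"] by auto
      then have "i = p" using family_disjoint[OF f i(1) p(1)] mem by blast
      then show False using i p by simp
    qed
    moreover have "family c j (S[p := j]) (\<pi>(p := q))"
    proof -
      have "hd q = (1, Suc p)" using D(3)[OF p(1)] True unfolding q by auto
      then have "limited_path c j ((\<pi>(p := q)) i) \<and>
          connects ((\<pi>(p := q)) i) (1, Suc i) (c, S[p := j] ! i)" if "i < length S" for i
        using that jq True other D[OF that] by (auto simp: connects_def nth_list_update)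
      moreover have "disjoint_family_on (\<lambda>i. set ((\<pi>(p := q)) i)) {..<length S}"
      proof -
        have "set ((\<pi>(p := q)) i) \<subseteq> set (\<pi> i)" for i using q by auto
        then show ?thesis using f unfolding family_def disjoint_family_on_def by blast
      qed
      ultimately show ?thesis by (simp add: family_def)
    qed
    moreover have "\<pi> = (\<pi>(p := q))(p := (\<pi>(p := q)) p @ [(c, Suc j)])" using q by auto
    ultimately show ?thesis by blast
  next
    case False
    then have "limited_path c j (\<pi> p)" using cs jq unfolding q limited_path_snoc by (auto simp: prod_eq_iff)
    then have "family c j S \<pi>" using other f unfolding family_def by metis
    then show ?thesis by simp
  qed
qed

lemma family_weight_extend:
  assumes "p < length S"
  shows "family_weight A S (\<pi>(p := \<pi> p @ [v])) = A v + family_weight A (S[p := j]) \<pi>"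
proof -
  let ?\<pi> = "\<pi>(p := \<pi> p @ [v])"
  have "family_weight A S ?\<pi> = (\<Sum>v\<leftarrow>?\<pi> p. A v) + (\<Sum>i\<in>{..<length S} - {p}. \<Sum>v\<leftarrow>?\<pi> i. A v)"
    unfolding family_weight_def using assms by (subst sum.remove[of _ p]) auto
  also have "(\<Sum>i\<in>{..<length S} - {p}. \<Sum>v\<leftarrow>?\<pi> i. A v) = (\<Sum>i\<in>{..<length S} - {p}. \<Sum>v\<leftarrow>\<pi> i. A v)"
    by (intro sum.cong) auto
  also have "(\<Sum>v\<leftarrow>?\<pi> p. A v) + \<dots> = A v + ((\<Sum>v\<leftarrow>\<pi> p. A v) + \<dots>)" by simp
  also have "(\<Sum>v\<leftarrow>\<pi> p. A v) + (\<Sum>i\<in>{..<length S} - {p}. \<Sum>v\<leftarrow>\<pi> i. A v) = family_weight A (S[p := j]) \<pi>"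
    unfolding family_weight_def using assms by (subst (2) sum.remove[of _ p]) auto
  finally show ?thesis .
qed

text \<open>
  The counterpart of \<open>minor_step\<close>. If \<open>j\<close> and \<open>j + 1\<close> both belong to
  \<open>S\<close> then no family extends, while on the side of determinants the additional minor has two equal
  rows.
\<close>

lemma weights_step:
  assumes "p < length S" "S ! p = Suc j" "distinct S"
  shows "weights A c (Suc j) S = weights A c j S \<union>
    (if j \<in> set S then {} else (+) (A (c, Suc j)) ` weights A c j (S[p := j]))"
proof (intro equalityI subsetI)
  fix x assume "x \<in> weights A c (Suc j) S"
  then obtain \<pi> where f: "family c (Suc j) S \<pi>" and x: "x = family_weight A S \<pi>"
    unfolding weights_def by blast
  from family_step_cases[OF f assms] show "x \<in> weights A c j S \<union>
      (if j \<in> set S then {} else (+) (A (c, Suc j)) ` weights A c j (S[p := j]))"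
  proof (elim disjE conjE exE)
    assume "family c j S \<pi>"
    then show ?thesis unfolding weights_def x by blast
  next
    fix \<pi>' assume *: "j \<notin> set S" "family c j (S[p := j]) \<pi>'" "\<pi> = \<pi>'(p := \<pi>' p @ [(c, Suc j)])"
    have "x = A (c, Suc j) + family_weight A (S[p := j]) \<pi>'"
      unfolding x *(3) by (rule family_weight_extend[OF assms(1)])
    then show ?thesis using *(1,2) unfolding weights_def by auto
  qed
next
  fix x assume *: "x \<in> weights A c j S \<union>
      (if j \<in> set S then {} else (+) (A (c, Suc j)) ` weights A c j (S[p := j]))"
  show "x \<in> weights A c (Suc j) S"
  proof (cases "x \<in> weights A c j S")
    case True
    then show ?thesis using family_mono unfolding weights_def by blast
  next
    case False
    then obtain \<pi> where f: "family c j (S[p := j]) \<pi>"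
      and x: "x = A (c, Suc j) + family_weight A (S[p := j]) \<pi>"
      using * unfolding weights_def by (auto split: if_splits)
    show ?thesis
      unfolding weights_def x family_weight_extend[OF assms(1), symmetric]
      using family_step_extend[OF f assms] by blast
  qed
qed

text \<open>
  A family at stage 0 of a column arises from one in the previous column, without limits, by extending every
  path by one horizontal step. This corresponds to \<open>minor_next_column\<close>.
\<close>

lemma weights_next_column:
  assumes c: "c \<ge> 1" and J: "\<forall>s\<in>set S. s \<le> J"
  shows "weights A (Suc c) 0 S = (+) (\<Sum>s\<leftarrow>S. A (Suc c, s)) ` weights A c J S"
proof -
  have wt: "family_weight A S (\<lambda>i. \<pi> i @ [(Suc c, S ! i)]) = (\<Sum>s\<leftarrow>S. A (Suc c, s)) + family_weight A S \<pi>" for \<pi>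
    by (simp add: family_weight_def sum.distrib sum.list_conv_set_nth[of "map _ S"] atLeast0LessThan)
  have ext: "family (Suc c) 0 S (\<lambda>i. \<pi> i @ [(Suc c, S ! i)])" if f: "family c J S \<pi>" for \<pi>
  proof -
    have col: "fst v \<le> c" if "i < length S" "v \<in> set (\<pi> i)" for i v
      using up_right_path_bounds(3)[OF limited_path_imp_up_right[OF familyD(1)[OF f that(1)]] that(2)]
        familyD(4)[OF f that(1)] by simp
    have ends: "limited_path (Suc c) 0 (\<pi> i @ [(Suc c, S ! i)]) \<and>
        connects (\<pi> i @ [(Suc c, S ! i)]) (1, Suc i) (Suc c, S ! i)" if i: "i < length S" for i
    proof -
      have "limited_path (Suc c) 0 (\<pi> i)"
      proof (subst limited_path_unrestricted)
        fix v assume "v \<in> set (\<pi> i)" "fst v = Suc c"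
        then show "snd v \<le> 0" using col[OF i] by fastforce
      qed (rule limited_path_imp_up_right[OF familyD(1)[OF f i]])
      then show ?thesis using familyD[OF f i] by (auto simp: limited_path_snoc connects_def)
    qed
    have "distinct S"
    proof -
      have mem: "(c, S ! i) \<in> set (\<pi> i)" if "i < length S" for i
        using familyD(2,4)[OF f that] last_in_set by metis
      have "S ! i \<noteq> S ! k" if "i < length S" "k < length S" "i \<noteq> k" for i k
        using family_disjoint[OF f that(1,2) mem[OF that(1)]] mem[OF that(2)] that(3) by auto
      then show ?thesis by (auto simp: distinct_conv_nth)
    qed
    have "disjoint_family_on (\<lambda>i. set (\<pi> i @ [(Suc c, S ! i)])) {..<length S}"
      unfolding disjoint_family_on_def
    proof (intro ballI impI)
      fix i k assume ik: "i \<in> {..<length S}" "k \<in> {..<length S}" "i \<noteq> k"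
      have "set (\<pi> i) \<inter> set (\<pi> k) = {}" using family_disjoint[OF f] ik by blast
      moreover have "(Suc c, s) \<notin> set (\<pi> i)" "(Suc c, s) \<notin> set (\<pi> k)" for s
        using col ik by force+
      moreover have "S ! i \<noteq> S ! k" using ik \<open>distinct S\<close> by (simp add: nth_eq_iff_index_eq)
      ultimately show "set (\<pi> i @ [(Suc c, S ! i)]) \<inter> set (\<pi> k @ [(Suc c, S ! k)]) = {}" by auto
    qed
    then show ?thesis using ends by (simp add: family_def)
  qed
  \<comment> \<open>Conversely, a vertical step cannot end in \<open>(Suc c, s)\<close> at stage 0, so every path ends with a horizontal step.\<close>
  have res: "family c J S (\<lambda>i. butlast (\<pi> i)) \<and>
      family_weight A S \<pi> = family_weight A S (\<lambda>i. butlast (\<pi> i) @ [(Suc c, S ! i)])"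
    if f: "family (Suc c) 0 S \<pi>" for \<pi>
  proof -
    have eq: "\<pi> i = butlast (\<pi> i) @ [(Suc c, S ! i)]" if "i < length S" for i
      using familyD[OF f that] by (metis append_butlast_last_id)
    have "limited_path c J (butlast (\<pi> i)) \<and> connects (butlast (\<pi> i)) (1, Suc i) (c, S ! i)"
      if i: "i < length S" for i
    proof -
      define q where "q = butlast (\<pi> i)"
      have q: "\<pi> i = q @ [(Suc c, S ! i)]" using eq[OF i] by (simp add: q_def)
      have ne: "q \<noteq> []" using familyD(3)[OF f i] c unfolding q by auto
      have l: "limited_path (Suc c) 0 q" "last q = (c, S ! i)"
        using familyD(1)[OF f i] ne unfolding q limited_path_snoc by (auto simp: prod_eq_iff)
      have "limited_path c J q"
      proof (subst limited_path_unrestricted)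
        show "up_right_path q" using l limited_path_imp_up_right by blast
        fix v assume v: "v \<in> set q"
        have "snd v \<le> S ! i"
          using up_right_path_bounds(4)[OF limited_path_imp_up_right[OF l(1)] v] l(2) by simp
        then show "snd v \<le> J" using J nth_mem[OF i] order_trans by blast
      qed
      moreover have "hd q = (1, Suc i)" using familyD(3)[OF f i] ne unfolding q by auto
      ultimately show ?thesis using ne l unfolding q_def[symmetric] by (auto simp: connects_def)
    qed
    moreover have "disjoint_family_on (\<lambda>i. set (butlast (\<pi> i))) {..<length S}"
    proof -
      have "set (butlast (\<pi> i)) \<subseteq> set (\<pi> i)" for i by (auto dest: in_set_butlastD)
      then show ?thesis using f unfolding family_def disjoint_family_on_def by blast
    qed
    moreover have "family_weight A S \<pi> = family_weight A S (\<lambda>i. butlast (\<pi> i) @ [(Suc c, S ! i)])"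
      unfolding family_weight_def 
      by (intro sum.cong refl arg_cong[where f = "\<lambda>p. sum_list (map A p)"] eq) auto
    ultimately show ?thesis by (simp add: family_def)
  qed
  show ?thesis
  proof (intro equalityI subsetI)
    fix x assume "x \<in> weights A (Suc c) 0 S"
    then show "x \<in> (+) (\<Sum>s\<leftarrow>S. A (Suc c, s)) ` weights A c J S"
      using res wt unfolding weights_def by (auto intro!: image_eqI)
  next
    fix x assume "x \<in> (+) (\<Sum>s\<leftarrow>S. A (Suc c, s)) ` weights A c J S"
    then show "x \<in> weights A (Suc c) 0 S"
      using ext wt[symmetric] unfolding weights_def by auto
  qed
qed

section \<open>Minors record maximal weights of families\<close>

lemma path_in_one_column:
  assumes "limited_path c 0 p" "p \<noteq> []" "fst (hd p) = c" "fst (last p) = c"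
  shows "p = [hd p]"
proof -
  have all: "v = last p" if "v \<in> set p" for v
    using limited_path_top[OF assms(1,4) that] that assms(3,4)
      up_right_path_bounds(1,3)[OF limited_path_imp_up_right[OF assms(1)] that] by simp
  show ?thesis
  proof (cases p rule: remdups_adj.cases)
    case (3 x y zs)
    then have "x = y" using all[of x] all[of y] by simp
    then show ?thesis using assms(1) 3 by (auto simp: limited_path_def prod_eq_iff)
  qed (use assms in auto)
qed

lemma strictly_sorted_initial:
  assumes "sorted_wrt (<) S" "\<forall>s\<in>set S. 1 \<le> s \<and> s \<le> length S"
  shows "S = [1..<Suc (length S)]"
proof -
  have "set S = {1..length S}"
    using assms(2) distinct_card[of S] assms(1)
    by (intro card_subset_eq) (auto simp: strict_sorted_iff)
  then show ?thesis
    using assms(1) sorted_distinct_set_unique[of S "[1..<Suc (length S)]"]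
    by (simp add: strict_sorted_iff atLeastLessThanSuc_atLeastAtMost del: upt_Suc)
qed

lemma rdet_column_0_initial: "rdet (map (path_poly A 0) [1..<Suc k]) = 1"
proof -
  have "mat k k (\<lambda>(i, j). (map (path_poly A 0) [1..<Suc k] ! i) j) = 1\<^sub>m k"
    by (rule eq_matI) (auto simp del: upt_Suc)
  then show ?thesis by (simp add: rdet_def del: upt_Suc)
qed

lemma rdet_column_0_outside:
  assumes "s \<in> set S" "s = 0 \<or> length S < s"
  shows "rdet (map (path_poly A 0) S) = 0"
proof -
  obtain i where "i < length S" "S ! i = s" using assms by (auto simp: in_set_conv_nth)
  then show ?thesis using assms(2) by (intro rdet_zero_row[of i]) auto
qed

text \<open>
  At stage 0 of the first column all paths consist of their starting points, and the minor is, up to a monomial,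
  one of the identity matrix.
\<close>

lemma minor_records_max_initial:
  assumes S: "sorted_wrt (<) S"
  shows "records_max (minor A 1 0 S) (weights A 1 0 S)"
proof -
  define J where "J = Max (insert 0 (set S))"
  have J: "\<forall>s\<in>set S. s \<le> J" by (auto simp: J_def)
  have "minor A 0 J S = rdet (map (path_poly A 0) S)"
    unfolding minor_def using J by (intro arg_cong[where f = rdet]) (auto simp: state_row_def)
  then have minor: "minor A 1 0 S = monom 1 (\<Sum>s\<leftarrow>S. A (1, s)) * rdet (map (path_poly A 0) S)"
    using minor_next_column[OF J, of A 0] by (simp add: prod_list_monom)
  have fam: "\<pi> i = [(1, Suc i)] \<and> S ! i = Suc i" if "family 1 0 S \<pi>" "i < length S" for \<pi> i
    using path_in_one_column[of 1 "\<pi> i"] familyD[OF that] by auto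
  show ?thesis
  proof (cases "\<forall>s\<in>set S. 1 \<le> s \<and> s \<le> length S")
    case True
    then have eq: "S = [1..<Suc (length S)]" by (rule strictly_sorted_initial[OF S])
    then have nth: "S ! i = Suc i" if "i < length S" for i
      using that by (metis nth_upt plus_1_eq_Suc add_less_cancel_left)
    have "rdet (map (path_poly A 0) S) = 1"
      using rdet_column_0_initial[of A "length S"] eq by metis
    then have minor: "minor A 1 0 S = monom 1 (\<Sum>s\<leftarrow>S. A (1, s))" using minor by simp
    have wt: "family_weight A S \<pi> = (\<Sum>s\<leftarrow>S. A (1, s))" if "\<forall>i<length S. \<pi> i = [(1, Suc i)]" for \<pi>
      using that nth by (simp add: family_weight_def sum.list_conv_set_nth[of "map _ S"] atLeast0LessThan)
    have "family 1 0 S (\<lambda>i. [(1, Suc i)])"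
      by (auto simp: family_def limited_path_def connects_def disjoint_family_on_def nth)
    then have "family_weight A S (\<lambda>i. [(1, Suc i)]) \<in> weights A 1 0 S"
      unfolding weights_def by blast
    then have "(\<Sum>s\<leftarrow>S. A (1, s)) \<in> weights A 1 0 S"
      by (subst (asm) wt) simp_all
    moreover have "x = (\<Sum>s\<leftarrow>S. A (1, s))" if "x \<in> weights A 1 0 S" for x
      using that wt fam unfolding weights_def by blast
    ultimately have "weights A 1 0 S = {\<Sum>s\<leftarrow>S. A (1, s)}" by blast
    then show ?thesis unfolding minor by (simp add: records_max_def monom_pos degree_monom_eq)
  next
    case False
    then obtain s where s: "s \<in> set S" "s = 0 \<or> length S < s" by fastforce
    have "weights A 1 0 S = {}"
    proof (rule ccontr)
      assume "weights A 1 0 S \<noteq> {}"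
      then obtain \<pi> where "family 1 0 S \<pi>" by (auto simp: weights_def)
      then have "S ! i = Suc i" if "i < length S" for i using fam that by blast
      then show False using s by (auto simp: in_set_conv_nth)
    qed
    then show ?thesis using minor rdet_column_0_outside[OF s, of A] by (simp add: records_max_def)
  qed
qed

text \<open>
  A max-plus version of the Lindstroem-Gessel-Viennot lemma: a minor records the maximal weight of a family of
  disjoint paths. Minors and sets of weights start from matching values and follow the same recursion through
  the stages of each column.
\<close>

theorem minor_records_max:
  assumes "c \<ge> 1" "sorted_wrt (<) S"
  shows "records_max (minor A c j S) (weights A c j S)"
proof -
  have step: "records_max (minor A c (Suc j) S) (weights A c (Suc j) S)"
    if c: "c \<ge> 1" and IH: "\<And>S. sorted_wrt (<) S \<Longrightarrow> records_max (minor A c j S) (weights A c j S)"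
      and S: "sorted_wrt (<) S" for c j S
  proof (cases "Suc j \<in> set S")
    case False
    then show ?thesis using IH[OF S] by (simp add: minor_step_notin weights_def family_step_notin)
  next
    case True
    then obtain p where p: "p < length S" "S ! p = Suc j" by (auto simp: in_set_conv_nth)
    have d: "distinct S" using S by (simp add: strict_sorted_iff)
    show ?thesis
    proof (cases "j \<in> set S")
      case True
      then obtain q where q: "q < length S" "S ! q = j" by (auto simp: in_set_conv_nth)
      then have "minor A c j (S[p := j]) = 0"
        using p by (intro minor_repeated[of p _ q]) (auto simp: nth_list_update)
      then show ?thesis
        using IH[OF S] True by (simp add: minor_step[OF c d p] weights_step[OF p d])
    next
      case False
      have "sorted_wrt (<) (S[p := j])"
        unfolding sorted_wrt_iff_nth_less
      proof (intro allI impI)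
        fix a b assume ab: "a < b" "b < length (S[p := j])"
        then have lt: "S ! a < S ! b" using S by (simp add: sorted_wrt_iff_nth_less)
        have "S ! a \<noteq> j" using False ab by (metis length_list_update nth_mem order_less_trans)
        then show "S[p := j] ! a < S[p := j] ! b"
          using lt ab p by (auto simp: nth_list_update)
      qed
      then show ?thesis
        using records_max_add[OF IH[OF S] records_max_monom_mult[OF IH]] False
        by (simp add: minor_step[OF c d p] weights_step[OF p d])
    qed
  qed
  have next_column: "records_max (minor A (Suc c) 0 S) (weights A (Suc c) 0 S)"
    if c: "c \<ge> 1" and IH: "\<And>j S. sorted_wrt (<) S \<Longrightarrow> records_max (minor A c j S) (weights A c j S)"
      and S: "sorted_wrt (<) S" for c S
  proof -
    have J: "\<forall>s\<in>set S. s \<le> Max (insert 0 (set S))" by auto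
    show ?thesis
      unfolding minor_next_column[OF J] weights_next_column[OF c J] prod_list_monom
      by (rule records_max_monom_mult[OF IH[OF S]])
  qed
  from assms(1) show ?thesis using assms(2)
  proof (induction c arbitrary: j S rule: nat_induct_at_least)
    case base
    show ?case using base
      by (induction j arbitrary: S) (use minor_records_max_initial step in auto)
  next
    case (Suc c)
    show ?case using Suc.prems
      by (induction j arbitrary: S) (use Suc.hyps Suc.IH next_column step in auto)
  qed
qed

section \<open>The three-term relation\<close>

text \<open>
  The minor for families that end in the \<open>k\<close> highest points \<open>(m, n - k + 1), \<dots>, (m,
  n)\<close> of column \<open>m\<close>.
\<close>

definition corner_minor :: "(vertex \<Rightarrow> nat) \<Rightarrow> nat \<Rightarrow> nat \<Rightarrow> nat \<Rightarrow> int poly" where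
  "corner_minor A m n k = rdet (map (path_poly A m) [Suc n - k..<Suc n])"

lemma minor_eq_rdet:
  assumes "\<forall>s\<in>set S. s \<le> J"
  shows "minor A c J S = rdet (map (path_poly A c) S)"
  unfolding minor_def using assms by (intro arg_cong[where f = rdet]) (auto simp: state_row_def)

lemma corner_minor_eq_minor: "corner_minor A m n k = minor A m n [Suc n - k..<Suc n]"
  by (subst minor_eq_rdet) (auto simp: corner_minor_def)

lemma corner_minor_0 [simp]: "corner_minor A m n 0 = 1"
  by (simp add: corner_minor_def)

text \<open>
  If the rows are consecutive, each row operation after the first row of the run adds a multiple of one row of
  the determinant to another one.
\<close>

lemma minor_run:
  assumes "1 \<le> c"
  shows "minor A c (s + i) [s..<s + Suc l] = minor A c s [s..<s + Suc l]"
proof (induction i)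
  case (Suc i)
  let ?S = "[s..<s + Suc l]"
  have "minor A c (Suc (s + i)) ?S = minor A c (s + i) ?S"
  proof (cases "i < l")
    case True
    have "minor A c (Suc (s + i)) ?S =
        minor A c (s + i) ?S + monom 1 (A (c, Suc (s + i))) * minor A c (s + i) (?S[Suc i := s + i])"
      by (rule minor_step[OF assms]) (use True in \<open>auto simp del: upt_Suc\<close>)
    moreover have "minor A c (s + i) (?S[Suc i := s + i]) = 0"
      by (rule minor_repeated[of i _ "Suc i"]) (use True in \<open>auto simp del: upt_Suc\<close>)
    ultimately show ?thesis by simp
  next
    case False
    then show ?thesis by (intro minor_step_notin) auto
  qed
  then show ?case using Suc by simp
qed simp

text \<open>
  Undoing these row operations replaces all rows of column \<open>c + 1\<close> except for the lowest one by
  rows of column \<open>c\<close>. In this form the minors of two neighbouring columns have common rows.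
\<close>

lemma rdet_run:
  "rdet (map (path_poly A (Suc c)) [s..<s + Suc l]) =
     monom 1 (\<Sum>r = Suc s..<Suc s + l. A (Suc c, r)) *
     rdet (path_poly A (Suc c) s # map (path_poly A c) [Suc s..<Suc s + l])"
proof -
  let ?S = "[s..<s + Suc l]"
  \<comment> \<open>At stage \<open>s\<close> the row of \<open>s\<close> is complete, and the rows above it are scaled rows of column \<open>c\<close>.\<close>
  let ?f = "\<lambda>r. monom 1 (if r = s then 0 else A (Suc c, r)) :: int poly"
  let ?v = "\<lambda>r. if r = s then path_poly A (Suc c) r else path_poly A c r"
  have S: "?S = s # [Suc s..<Suc s + l]" by (simp add: upt_conv_Cons del: upt_Suc)
  have "rdet (map (path_poly A (Suc c)) ?S) = minor A (Suc c) (s + l) ?S"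
    by (subst minor_eq_rdet) auto
  also have "\<dots> = minor A (Suc c) s ?S" by (rule minor_run) simp
  also have "\<dots> = rdet (map (\<lambda>r j. ?f r * ?v r j) ?S)"
    unfolding minor_def
    by (intro arg_cong[where f = rdet]) (auto simp: state_row_def fun_eq_iff)
  also have "\<dots> = (\<Prod>r\<leftarrow>?S. ?f r) * rdet (map ?v ?S)" by (rule rdet_scale_rows)
  also have "map ?v ?S = path_poly A (Suc c) s # map (path_poly A c) [Suc s..<Suc s + l]"
    unfolding S by auto
  also have "(\<Prod>r\<leftarrow>?S. ?f r) = monom 1 (\<Sum>r\<leftarrow>?S. if r = s then 0 else A (Suc c, r))"
    by (rule prod_list_monom)
  also have "(\<Sum>r\<leftarrow>?S. if r = s then 0 else A (Suc c, r)) = (\<Sum>r = Suc s..<Suc s + l. A (Suc c, r))"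
    unfolding S by (simp add: interv_sum_list_conv_sum_set_nat cong: map_cong) 
  finally show ?thesis .
qed

text \<open>
  After \<open>rdet_run\<close> each of the six minors has rows from column \<open>m\<close> and at most one row
  from column \<open>m + 1\<close>, and the statement becomes the Pluecker relation. Only the last minor has a
  different row of column \<open>m + 1\<close>, the one below row \<open>s\<close>; the recursion of
  \<open>path_poly\<close> exchanges the two.
\<close>

lemma corner_minor_three_term:
  assumes "k \<le> n"
  shows "corner_minor A (Suc m) (Suc n) (Suc k) * corner_minor A m n k =
    monom 1 (A (Suc m, Suc n)) *
      (corner_minor A m (Suc n) (Suc k) * corner_minor A (Suc m) n k +
       corner_minor A m (Suc n) k * corner_minor A (Suc m) n (Suc k))"
proof (cases k)
  case 0
  have single: "rdet [v] = v 0" for v :: "nat \<Rightarrow> int poly"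
    using rdet_update[of 0 "[v]" v] by (simp add: rcof_def cofactor_def mat_delete_def)
  show ?thesis by (simp add: 0 corner_minor_def single)
next
  case (Suc l)
  then obtain t where n: "n = Suc (t + l)" using assms by (metis add.commute add_Suc le_Suc_ex)
  let ?P = "path_poly A (Suc m)" and ?Q = "path_poly A m"
  define s where "s = Suc t"
  define T where "T = map ?Q [Suc s..<Suc s + l]"
  define W where "W = (monom 1 (\<Sum>r = Suc s..<Suc s + l. A (Suc m, r)) :: int poly)"
  let ?w = "\<lambda>r. monom 1 (A (Suc m, r)) :: int poly"
  have n': "Suc n = Suc s + l" "n = s + l" by (simp_all add: n s_def)
  have upt: "[s..<s + Suc (Suc l)] = s # [Suc s..<Suc s + l] @ [Suc s + l]"
    "[s..<s + Suc l] = s # [Suc s..<Suc s + l]"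
    "[Suc s..<Suc s + Suc l] = [Suc s..<Suc s + l] @ [Suc s + l]"
    by (simp_all add: upt_conv_Cons)
  have d: "corner_minor A (Suc m) (Suc n) (Suc k) = W * ?w (Suc n) * rdet (?P s # T @ [?Q (Suc n)])"
  proof -
    have "corner_minor A (Suc m) (Suc n) (Suc k) = rdet (map ?P [s..<s + Suc (Suc l)])"
      by (simp add: corner_minor_def Suc n' del: upt_Suc)
    then show ?thesis unfolding rdet_run
      by (simp add: W_def T_def n' mult_monom)
  qed
  have c: "corner_minor A m n k = rdet (?Q s # T)"
    by (simp add: corner_minor_def Suc n' T_def upt_conv_Cons del: upt_Suc)
  have a: "corner_minor A m (Suc n) (Suc k) = rdet (?Q s # T @ [?Q (Suc n)])"
    "corner_minor A m (Suc n) k = rdet (T @ [?Q (Suc n)])"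
    using upt by (simp_all add: corner_minor_def Suc n' T_def del: upt_Suc)
  have b1: "corner_minor A (Suc m) n k = W * rdet (?P s # T)"
  proof -
    have "corner_minor A (Suc m) n k = rdet (map ?P [s..<s + Suc l])"
      by (simp add: corner_minor_def Suc n' del: upt_Suc)
    then show ?thesis unfolding rdet_run by (simp add: W_def T_def)
  qed
  have b2: "corner_minor A (Suc m) n (Suc k) = W * ?w s * rdet (?P t # ?Q s # T)"
  proof -
    have "corner_minor A (Suc m) n (Suc k) = rdet (map ?P [t..<t + Suc (Suc l)])"
      by (simp add: corner_minor_def Suc n del: upt_Suc)
    moreover have "(\<Sum>r = Suc t..<Suc t + Suc l. A (Suc m, r)) =
        (\<Sum>r = Suc s..<Suc s + l. A (Suc m, r)) + A (Suc m, s)"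
      by (subst sum.atLeast_Suc_lessThan) (auto simp: s_def simp del: sum.op_ivl_Suc)
    moreover have "[Suc t..<Suc t + Suc l] = s # [Suc s..<Suc s + l]"
      by (simp add: upt_conv_Cons s_def del: upt_Suc)
    ultimately show ?thesis unfolding rdet_run by (simp only: W_def T_def mult_monom list.map mult_1)
  qed
  \<comment> \<open>Row \<open>?P s\<close> is \<open>?w s\<close> times \<open>?Q s + ?P t\<close>, and \<open>?Q s\<close> already is a row.\<close>
  have "rdet (?P s # ?Q s # T) = ?w s * rdet (?P t # ?Q s # T)"
  proof -
    have "rdet (?P s # ?Q s # T) = rdet ((?Q s # ?Q s # T)[0 := (\<lambda>j. (0 + ?w s * ?Q s j) + ?w s * ?P t j)])"
      by (rule rdet_cong) (auto simp: s_def nth_Cons algebra_simps split: nat.split)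
    also have "\<dots> = rdet ((?Q s # ?Q s # T)[0 := (\<lambda>j. 0 + ?w s * ?Q s j)]) + ?w s * rdet (?P t # ?Q s # T)"
      by (subst rdet_row_linear) simp_all
    also have "rdet ((?Q s # ?Q s # T)[0 := (\<lambda>j. 0 + ?w s * ?Q s j)]) =
        rdet ((?Q s # ?Q s # T)[0 := (\<lambda>j. 0)]) + ?w s * rdet (?Q s # ?Q s # T)"
      by (subst rdet_row_linear) simp_all
    also have "rdet ((?Q s # ?Q s # T)[0 := (\<lambda>j. 0)]) = 0"
      by (rule rdet_zero_row[of 0]) auto
    also have "rdet (?Q s # ?Q s # T) = 0" by (rule rdet_equal_rows[of 0 _ 1]) auto
    finally show ?thesis by simp
  qed
  then have "rdet (?P s # T @ [?Q (Suc n)]) * rdet (?Q s # T) =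
      rdet (?Q s # T @ [?Q (Suc n)]) * rdet (?P s # T) +
      ?w s * rdet (?P t # ?Q s # T) * rdet (T @ [?Q (Suc n)])"
    using rdet_plucker[of "?P s" T "?Q (Suc n)" "?Q s"] by simp
  then have "corner_minor A (Suc m) (Suc n) (Suc k) * corner_minor A m n k = W * ?w (Suc n) * 
     (rdet (?Q s # T @ [?Q (Suc n)]) * rdet (?P s # T) +
      ?w s * rdet (?P t # ?Q s # T) * rdet (T @ [?Q (Suc n)]))"
    by (simp only: c d mult.assoc)
  then show ?thesis unfolding a b1 b2 by (simp add: algebra_simps)
qed

section \<open>The recurrence of last passage times\<close>

definition total_weight :: "(vertex \<Rightarrow> nat) \<Rightarrow> nat \<Rightarrow> nat \<Rightarrow> nat" where
  "total_weight A m n = (\<Sum>i = 1..m. \<Sum>j = 1..n. A (i, j))"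

lemma total_weight_0 [simp]: "total_weight A 0 n = 0" "total_weight A m 0 = 0"
  by (simp_all add: total_weight_def)

lemma total_weight_Suc_Suc:
  "total_weight A (Suc m) (Suc n) + total_weight A m n = A (Suc m, Suc n) + (total_weight A m (Suc n) + total_weight A (Suc m) n)"
  by (simp add: total_weight_def sum.distrib)

lemma corner_minor_nonneg: "k \<le> n \<Longrightarrow> 0 \<le> corner_minor A m n k"
proof (cases m)
  case 0
  assume k: "k \<le> n"
  show ?thesis
  proof (cases "k = n")
    case True
    then show ?thesis using 0 rdet_column_0_initial[of A n] by (simp add: corner_minor_def del: upt_Suc)
  next
    case False
    then show ?thesis
      using 0 k rdet_column_0_outside[of n "[Suc n - k..<Suc n]" A]
      by (cases "k = 0") (auto simp: corner_minor_def simp del: upt_Suc)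
  qed
next
  case (Suc m')
  assume "k \<le> n"
  have "records_max (corner_minor A m n k) (weights A m n [Suc n - k..<Suc n])"
    unfolding corner_minor_eq_minor by (rule minor_records_max) (use Suc in \<open>auto simp del: upt_Suc\<close>)
  then show ?thesis by (auto simp: records_max_def)
qed

text \<open>
  With \<open>k = n\<close> no path can move up, and the only family covers the whole array.
\<close>

lemma corner_minor_full: "corner_minor A m n n = monom 1 (total_weight A m n)"
proof (induction m)
  case 0
  then show ?case
    using rdet_column_0_initial[of A n] by (simp add: corner_minor_def one_pCons monom_0 del: upt_Suc)
next
  case (Suc m)
  show ?case
  proof (cases n)
    case 0
    then show ?thesis by (simp add: one_pCons monom_0)
  next
    case n: (Suc l)
    let ?S = "[1..<1 + Suc l]"
    have J: "\<forall>s\<in>set ?S. s \<le> n" using n by auto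
    have "corner_minor A (Suc m) n n = minor A (Suc m) (1 + l) ?S"
      unfolding corner_minor_eq_minor n by simp
    also have "\<dots> = minor A (Suc m) 1 ?S" by (rule minor_run) simp
    also have "\<dots> = minor A (Suc m) 0 ?S"
    proof -
      have "state_row A (Suc m) 1 s = state_row A (Suc m) 0 s" if "s \<ge> 1" for s
        using that by (cases s) (auto simp: state_row_def fun_eq_iff algebra_simps)
      then have "map (state_row A (Suc m) 1) ?S = map (state_row A (Suc m) 0) ?S"
        by (intro map_cong) auto
      then show ?thesis by (simp only: minor_def)
    qed
    also have "\<dots> = monom 1 (\<Sum>s\<leftarrow>?S. A (Suc m, s)) * corner_minor A m n n"
      unfolding minor_next_column[OF J] prod_list_monom minor_eq_rdet[OF J]
      by (simp add: corner_minor_def n del: upt_Suc)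
    also have "(\<Sum>s\<leftarrow>?S. A (Suc m, s)) = (\<Sum>j = 1..n. A (Suc m, j))"
      by (simp add: n interv_sum_list_conv_sum_set_nat atLeastLessThanSuc_atLeastAtMost del: upt_Suc)
    finally show ?thesis
      unfolding Suc by (simp add: mult_monom total_weight_def add.commute)
  qed
qed

text \<open>
  In the three-term relation the second summand on the right is a product of minors that are positive by
  induction, and the first one is not negative.
\<close>

lemma corner_minor_pos: "k \<le> m \<Longrightarrow> k \<le> n \<Longrightarrow> 0 < corner_minor A m n k"
proof (induction "m + n" arbitrary: m n k rule: less_induct)
  case less
  show ?case
  proof (cases "k = 0 \<or> k = n")
    case True
    then show ?thesis by (auto simp: corner_minor_full monom_pos)
  next
    case False
    then obtain m' n' k' where eq: "m = Suc m'" "n = Suc n'" "k = Suc k'"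
      using less.prems by (cases m; cases n; cases k) auto
    have pos: "0 < corner_minor A m' n' k'" "0 < corner_minor A m' (Suc n') k'"
      "0 < corner_minor A (Suc m') n' (Suc k')"
      using False less.prems by (auto intro!: less.hyps simp: eq)
    have "0 < monom 1 (A (Suc m', Suc n')) *
      (corner_minor A m' (Suc n') (Suc k') * corner_minor A (Suc m') n' k' +
       corner_minor A m' (Suc n') k' * corner_minor A (Suc m') n' (Suc k'))"
      using pos less.prems False
      by (intro mult_pos_pos add_nonneg_pos mult_nonneg_nonneg corner_minor_nonneg monom_pos)
        (auto simp: eq)
    then have "0 < corner_minor A (Suc m') (Suc n') (Suc k') * corner_minor A m' n' k'"
      using less.prems by (subst corner_minor_three_term) (auto simp: eq)
    then show ?thesis using pos(1) by (simp add: eq zero_less_mult_iff)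
  qed
qed

lemma up_right_path_distinct: "up_right_path p \<Longrightarrow> distinct p"
proof (induction p rule: induct_list012)
  case (3 x y zs)
  then have r: "up_right_path (y # zs)" "y = (fst x, snd x + 1) \<or> y = (fst x + 1, snd x)"
    by (auto simp: up_right_path_def)
  have "x \<notin> set (y # zs)"
    using up_right_path_bounds(1,2)[OF r(1), of x] r(2) by (cases x) auto
  then show ?case using 3(2)[OF r(1)] by simp
qed auto

lemma weights_le_total_weight:
  assumes "w \<in> weights A m n S" "\<forall>s\<in>set S. s \<le> n"
  shows "w \<le> total_weight A m n"
proof -
  obtain \<pi> where f: "family m n S \<pi>" and w: "w = family_weight A S \<pi>"
    using assms(1) by (auto simp: weights_def)
  have up: "up_right_path (\<pi> i)" if "i < length S" for i
    using limited_path_imp_up_right familyD(1)[OF f that] by blast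
  have "w = (\<Sum>i<length S. \<Sum>v\<in>set (\<pi> i). A v)"
    unfolding w family_weight_def
    by (intro sum.cong refl sum_list_distinct_conv_sum_set up_right_path_distinct up) auto
  also have "\<dots> = (\<Sum>v\<in>(\<Union>i<length S. set (\<pi> i)). A v)"
    using family_disjoint[OF f] by (subst sum.UNION_disjoint) auto
  also have "\<dots> \<le> (\<Sum>v\<in>{1..m} \<times> {1..n}. A v)"
  proof (rule sum_mono2)
    show "(\<Union>i<length S. set (\<pi> i)) \<subseteq> {1..m} \<times> {1..n}"
    proof (intro UN_least subsetI)
      fix i v assume "i \<in> {..<length S}" and v: "v \<in> set (\<pi> i)"
      then have i: "i < length S" by simp
      have "S ! i \<le> n" using assms(2) i by simp
      then show "v \<in> {1..m} \<times> {1..n}"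
        using up_right_path_bounds[OF up[OF i] v] familyD(3,4)[OF f i]
        by (cases v) auto
    qed
  qed auto
  also have "\<dots> = total_weight A m n" by (simp add: total_weight_def sum.cartesian_product)
  finally show ?thesis .
qed

lemma corner_minor_records_max:
  assumes "m \<ge> 1"
  shows "records_max (corner_minor A m n k) (weights A m n [Suc n - k..<Suc n])"
  unfolding corner_minor_eq_minor by (rule minor_records_max) (use assms in \<open>auto simp del: upt_Suc\<close>)

lemma degree_corner_minor_le:
  assumes "k \<le> m" "k \<le> n"
  shows "degree (corner_minor A m n k) \<le> total_weight A m n"
proof (cases "m = 0")
  case True
  then show ?thesis using assms by simp
next
  case False
  then have "degree (corner_minor A m n k) \<in> weights A m n [Suc n - k..<Suc n]"
    using corner_minor_records_max[of m A n k] corner_minor_pos[OF assms, of A]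
    by (auto simp: records_max_def)
  then show ?thesis by (rule weights_le_total_weight) auto
qed

lemma degree_three_term:
  assumes "Suc k \<le> m" "Suc k \<le> n"
  shows "degree (corner_minor A (Suc m) (Suc n) (Suc k)) + degree (corner_minor A m n k) =
    A (Suc m, Suc n) +
      max (degree (corner_minor A m (Suc n) (Suc k)) + degree (corner_minor A (Suc m) n k))
          (degree (corner_minor A m (Suc n) k) + degree (corner_minor A (Suc m) n (Suc k)))"
proof -
  have pos: "0 < corner_minor A m' n' k'" if "m' \<ge> m" "n' \<ge> n" "k' \<le> Suc k" for m' n' k'
    using that assms by (intro corner_minor_pos) auto
  define U where "U = corner_minor A m (Suc n) (Suc k) * corner_minor A (Suc m) n k"
  define V where "V = corner_minor A m (Suc n) k * corner_minor A (Suc m) n (Suc k)"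
  have U: "0 < U" "degree U = degree (corner_minor A m (Suc n) (Suc k)) + degree (corner_minor A (Suc m) n k)"
    and V: "0 < V" "degree V = degree (corner_minor A m (Suc n) k) + degree (corner_minor A (Suc m) n (Suc k))"
    unfolding U_def V_def by (simp_all add: degree_mult_eq pos pos[THEN order_less_imp_not_eq2])
  have "corner_minor A (Suc m) (Suc n) (Suc k) * corner_minor A m n k =
      monom 1 (A (Suc m, Suc n)) * (U + V)"
    unfolding U_def V_def using assms by (intro corner_minor_three_term) simp
  then have "degree (corner_minor A (Suc m) (Suc n) (Suc k) * corner_minor A m n k) =
      degree (monom 1 (A (Suc m, Suc n)) * (U + V))" by simp
  moreover have "U + V \<noteq> 0" using add_pos_pos[OF U(1) V(1)] by simp
  ultimately show ?thesis
    using U V by (simp add: degree_mult_eq degree_monom_eq monom_eq_0_iff degree_add_pos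
        pos[THEN order_less_imp_not_eq2])
qed

text \<open>
  For \<open>k = min m n\<close> the last passage time is the sum of all entries, so that both clauses in the
  definition of \<open>last_passage\<close> agree there. If \<open>m < n\<close>, the three-term relation bounds
  the degree from below by induction; the bound from above holds because disjoint paths use every entry at most
  once.
\<close>

lemma degree_corner_minor_saturated:
  "k = min m n \<Longrightarrow> degree (corner_minor A m n k) = total_weight A m n"
proof (induction "m + n" arbitrary: m n k rule: less_induct)
  case less
  show ?case
  proof (cases "m < n \<and> m > 0")
    case False
    then have "k = n \<or> k = 0 \<and> m = 0" using less.prems by auto
    then show ?thesis by (auto simp: corner_minor_full degree_monom_eq)
  next
    case True
    then obtain m' n' where eq: "m = Suc m'" "n = Suc n'" "k = Suc m'" "Suc m' \<le> n'"
      using less.prems by (cases m; cases n) auto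
    let ?c = "corner_minor A"
    have IH: "degree (?c m' n' m') = total_weight A m' n'" "degree (?c m' (Suc n') m') = total_weight A m' (Suc n')"
      "degree (?c (Suc m') n' (Suc m')) = total_weight A (Suc m') n'"
      using eq by (auto intro!: less.hyps)
    have pos: "0 < ?c m' n' m'" "0 < ?c m' (Suc n') m'" "0 < ?c (Suc m') n' (Suc m')"
        "0 < ?c (Suc m') (Suc n') (Suc m')"
      using eq by (auto intro!: corner_minor_pos)
    define U where "U = ?c m' (Suc n') (Suc m') * ?c (Suc m') n' m'"
    define V where "V = ?c m' (Suc n') m' * ?c (Suc m') n' (Suc m')"
    have U: "0 \<le> U" unfolding U_def using eq by (intro mult_nonneg_nonneg corner_minor_nonneg) auto
    have V: "0 < V" unfolding V_def using pos by simp
    have "degree V \<le> degree (U + V)"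
      using U V by (cases "U = 0") (auto simp: degree_add_pos)
    moreover have "U + V \<noteq> 0" using U V add_nonneg_pos[of U V] by simp
    moreover have "?c (Suc m') (Suc n') (Suc m') * ?c m' n' m' = monom 1 (A (Suc m', Suc n')) * (U + V)"
      unfolding U_def V_def using eq by (intro corner_minor_three_term) simp
    then have "degree (?c (Suc m') (Suc n') (Suc m') * ?c m' n' m') = degree (monom 1 (A (Suc m', Suc n')) * (U + V))"
      by simp
    ultimately have "A (Suc m', Suc n') + degree V \<le> degree (?c (Suc m') (Suc n') (Suc m')) + degree (?c m' n' m')"
      using pos by (simp add: degree_mult_eq degree_monom_eq monom_eq_0_iff)
    moreover have "degree V = total_weight A m' (Suc n') + total_weight A (Suc m') n'"
      unfolding V_def using pos by (simp add: degree_mult_eq IH)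
    ultimately have "total_weight A (Suc m') (Suc n') \<le> degree (?c (Suc m') (Suc n') (Suc m'))"
      using total_weight_Suc_Suc[of A m' n'] IH(1) by simp
    moreover have "degree (?c (Suc m') (Suc n') (Suc m')) \<le> total_weight A (Suc m') (Suc n')"
      using eq by (intro degree_corner_minor_le) auto
    ultimately show ?thesis by (simp add: eq)
  qed
qed

definition passage :: "(vertex \<Rightarrow> nat) \<Rightarrow> nat \<Rightarrow> nat \<Rightarrow> nat \<Rightarrow> nat" where
  "passage A m n k = (if k \<le> min m n then degree (corner_minor A m n k) else total_weight A m n)"

lemma family_iff_disjoint_paths:
  assumes "k \<le> n"
  shows "family m n [Suc n - k..<Suc n] \<pi> \<longleftrightarrow> disjoint_paths m n k (\<lambda>i. \<pi> (i - 1))"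
proof -
  let ?S = "[Suc n - k..<Suc n]"
  have len: "length ?S = k" using assms by (simp del: upt_Suc)
  have nth: "?S ! i = n - k + Suc i" if "i < k" for i
    using assms that by (subst nth_upt) auto
  have "limited_path m n p \<longleftrightarrow> up_right_path p" if "connects p (1, Suc i) (m, n - k + Suc i)" "i < k" for p i
  proof
    assume up: "up_right_path p"
    have "snd v \<le> n" if "v \<in> set p" for v
      using up_right_path_bounds(4)[OF up that] \<open>connects p _ _\<close> \<open>i < k\<close> assms by (simp add: connects_def)
    then show "limited_path m n p" using up by (subst limited_path_unrestricted)
  qed (rule limited_path_imp_up_right)
  moreover have "{1..k} = Suc ` {..<k}"
    by (simp add: image_Suc_lessThan)
  ultimately show ?thesis
    unfolding family_def disjoint_paths_def len
    by (auto simp: nth disjoint_family_on_def simp del: upt_Suc)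
qed

text \<open>
  At stage \<open>n\<close> of column \<open>m\<close> there is no restriction on paths that end in row
  \<open>n\<close> or below, so the families are those over which \<open>last_passage\<close> maximizes.
\<close>

lemma last_passage_eq_passage: "last_passage m n (\<lambda>u. real (A u)) k = real (passage A m n k)"
proof (cases "k \<le> min m n")
  case False
  then show ?thesis unfolding last_passage_def passage_def total_weight_def by (simp only: if_False) simp
next
  case True
  let ?S = "[Suc n - k..<Suc n]"
  have len: "length ?S = k" using True by (simp del: upt_Suc)
  have pw: "path_weight (\<lambda>u. real (A u)) p = real (\<Sum>v\<leftarrow>p. A v)" for p
    by (induction p) (auto simp: path_weight_def)
  have wt: "(\<Sum>i=1..k. path_weight (\<lambda>u. real (A u)) (\<pi> (i - 1))) = real (family_weight A ?S \<pi>)" for \<pi>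
  proof -
    have "(\<Sum>i=1..k. path_weight (\<lambda>u. real (A u)) (\<pi> (i - 1))) = (\<Sum>i<k. path_weight (\<lambda>u. real (A u)) (\<pi> i))"
      by (simp add: sum.atLeast1_atMost_eq)
    then show ?thesis
      unfolding family_weight_def len by (simp add: pw)
  qed
  have "{\<Sum>i=1..k. path_weight (\<lambda>u. real (A u)) (\<pi> i) | \<pi>. disjoint_paths m n k \<pi>} =
      real ` weights A m n ?S" (is "?L = ?R")
  proof (intro equalityI subsetI)
    fix x assume "x \<in> ?L"
    then obtain \<pi> where \<pi>: "disjoint_paths m n k \<pi>" "x = (\<Sum>i=1..k. path_weight (\<lambda>u. real (A u)) (\<pi> i))"
      by blast
    define \<rho> where "\<rho> i = \<pi> (Suc i)" for i
    have "disjoint_paths m n k (\<lambda>i. \<rho> (i - 1))"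
      using \<pi>(1) by (auto simp: disjoint_paths_def disjoint_family_on_def \<rho>_def)
    then have "family m n ?S \<rho>" using True by (subst family_iff_disjoint_paths) auto
    moreover have "x = real (family_weight A ?S \<rho>)"
      unfolding wt[symmetric] \<pi>(2) by (intro sum.cong) (auto simp: \<rho>_def)
    ultimately show "x \<in> ?R" unfolding weights_def by blast
  next
    fix x assume "x \<in> ?R"
    then obtain \<pi> where \<pi>: "family m n ?S \<pi>" "x = real (family_weight A ?S \<pi>)"
      unfolding weights_def by blast
    have "disjoint_paths m n k (\<lambda>i. \<pi> (i - 1))"
      using \<pi>(1) family_iff_disjoint_paths[of k n m \<pi>] True by simp
    then show "x \<in> ?L" unfolding \<pi>(2) wt[symmetric]
      by (intro CollectI exI[where x = "\<lambda>i. \<pi> (i - 1)"] conjI refl)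
  qed
  then have "last_passage m n (\<lambda>u. real (A u)) k = Max (real ` weights A m n ?S)"
    using True by (simp only: last_passage_def if_True)
  also have "\<dots> = real (degree (corner_minor A m n k))"
  proof (cases "m = 0")
    case True
    then have "k = 0" using \<open>k \<le> min m n\<close> by simp
    then have "weights A m n ?S = {0}"
      by (auto simp: weights_def family_def family_weight_def disjoint_family_on_def)
    then show ?thesis using \<open>k = 0\<close> by simp
  next
    case False
    then have *: "degree (corner_minor A m n k) \<in> weights A m n ?S"
      "\<forall>v\<in>weights A m n ?S. v \<le> degree (corner_minor A m n k)"
      using corner_minor_records_max[of m A n k] corner_minor_pos[of k m n A] True
      by (auto simp: records_max_def)
    then have "finite (weights A m n ?S)" by (meson finite_nat_set_iff_bounded_le)
    then show ?thesis using * by (intro Max_eqI) auto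
  qed
  finally show ?thesis using True by (simp add: passage_def)
qed

lemma passage_0 [simp]: "passage A m n 0 = 0" "passage A 0 n k = 0" "passage A m 0 k = 0"
  by (auto simp: passage_def)

lemma passage_saturated: "min m n \<le> k \<Longrightarrow> passage A m n k = total_weight A m n"
  by (auto simp: passage_def degree_corner_minor_saturated)

lemma passage_le_total_weight: "passage A m n k \<le> total_weight A m n"
  by (simp add: passage_def degree_corner_minor_le)

text \<open>
  Below \<open>min m n\<close> this compares degrees in the three-term relation. Otherwise the left-hand side
  and one of the two terms in the maximum consist of total weights of subarrays, the other term is at most that
  one, and the claim is inclusion-exclusion.
\<close>

theorem passage_recurrence:
  "passage A (Suc m) (Suc n) (Suc k) + passage A m n k =
     A (Suc m, Suc n) +
       max (passage A m (Suc n) (Suc k) + passage A (Suc m) n k)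
           (passage A m (Suc n) k + passage A (Suc m) n (Suc k))"
proof (cases "k < min m n")
  case True
  then show ?thesis using degree_three_term[of k m n A] by (simp add: passage_def)
next
  case False
  then consider "m \<le> k" | "n \<le> k" by linarith
  then show ?thesis
  proof cases
    case 1
    then show ?thesis
      using total_weight_Suc_Suc[of A m n] passage_le_total_weight[of A "Suc m" n k]
      by (simp add: passage_saturated)
  next
    case 2
    then show ?thesis
      using total_weight_Suc_Suc[of A m n] passage_le_total_weight[of A m "Suc n" k]
      by (simp add: passage_saturated)
  qed
qed

section \<open>The local growth rule\<close>

text \<open>
  Fomin's local growth rule of the Robinson-Schensted-Knuth correspondence, in its piecewise linear form, where
  \<open>\<nu>\<close> and \<open>\<kappa>\<close> are the shapes at the left and lower neighbour and
  \<open>\<mu>\<close> is the shape at the diagonal neighbour. The subtraction does not truncate because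
  \<open>\<mu>\<close> interlaces with \<open>\<nu>\<close> and \<open>\<kappa>\<close>.
\<close>

definition local_rule ::
    "(nat \<Rightarrow> nat) \<Rightarrow> (nat \<Rightarrow> nat) \<Rightarrow> (nat \<Rightarrow> nat) \<Rightarrow> nat \<Rightarrow> nat \<Rightarrow> nat" where
  "local_rule \<nu> \<kappa> \<mu> w k =
     (case k of
        0 \<Rightarrow> max (\<nu> 0) (\<kappa> 0) + w
      | Suc i \<Rightarrow> max (\<nu> (Suc i)) (\<kappa> (Suc i)) + min (\<nu> i) (\<kappa> i) - \<mu> i)"

lemma local_rule_interlaces:
  assumes "interlaces \<nu> \<mu>" "interlaces \<kappa> \<mu>"
  shows "interlaces (local_rule \<nu> \<kappa> \<mu> w) \<nu>" "interlaces (local_rule \<nu> \<kappa> \<mu> w) \<kappa>"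
proof -
  have "\<nu> k \<le> local_rule \<nu> \<kappa> \<mu> w k \<and> \<kappa> k \<le> local_rule \<nu> \<kappa> \<mu> w k \<and>
      local_rule \<nu> \<kappa> \<mu> w (Suc k) \<le> \<nu> k \<and> local_rule \<nu> \<kappa> \<mu> w (Suc k) \<le> \<kappa> k" for k
  proof -
    have i: "\<mu> j \<le> \<nu> j" "\<nu> (Suc j) \<le> \<mu> j" "\<mu> j \<le> \<kappa> j" "\<kappa> (Suc j) \<le> \<mu> j" for j
      using assms by (auto simp: interlaces_def)
    show ?thesis using i[of k] i[of "k - 1"]
      by (cases k) (auto simp: local_rule_def max_def min_def)
  qed
  then show "interlaces (local_rule \<nu> \<kappa> \<mu> w) \<nu>" "interlaces (local_rule \<nu> \<kappa> \<mu> w) \<kappa>"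
    by (auto simp: interlaces_def)
qed

text \<open>
  The partial sums of \<open>\<rho> = local_rule \<nu> \<kappa> \<mu> w\<close> satisfy the recurrence of last
  passage times. The step of the induction uses \<open>max a b + min a b = a + b\<close>.
\<close>

lemma local_rule_sums:
  assumes "interlaces \<nu> \<mu>" "interlaces \<kappa> \<mu>"
  shows "sum (local_rule \<nu> \<kappa> \<mu> w) {..<Suc k} + sum \<mu> {..<k} =
    w + max (sum \<nu> {..<Suc k} + sum \<kappa> {..<k}) (sum \<nu> {..<k} + sum \<kappa> {..<Suc k})"
proof (induction k)
  case 0
  show ?case by (simp add: local_rule_def)
next
  case (Suc k)
  have "\<mu> k \<le> \<nu> k" "\<mu> k \<le> \<kappa> k" using assms by (auto simp: interlaces_def)
  then have "local_rule \<nu> \<kappa> \<mu> w (Suc k) + \<mu> k = max (\<nu> (Suc k)) (\<kappa> (Suc k)) + min (\<nu> k) (\<kappa> k)"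
    by (simp add: local_rule_def)
  then show ?case using Suc by (simp add: max_def min_def split: if_splits)
qed

lemma is_partition_suminf:
  assumes "is_partition p"
  shows "\<forall>\<^sub>F K in sequentially. (\<Sum>k. p k) = sum p {..<K}"
proof -
  obtain K where K: "\<And>k. k \<ge> K \<Longrightarrow> p k = 0"
    using assms by (auto simp: is_partition_def eventually_sequentially)
  have "(\<Sum>k. p k) = sum p {..<K'}" if "K' \<ge> K" for K'
    using K that by (intro suminf_finite) auto
  then show ?thesis by (auto simp: eventually_sequentially)
qed

text \<open>
  For large \<open>k\<close> both terms in the maximum of \<open>local_rule_sums\<close> are \<open>|\<nu>| +
  |\<kappa>|\<close>.
\<close>

lemma local_rule_size:
  assumes "interlaces \<nu> \<mu>" "interlaces \<kappa> \<mu>" "local_rule \<nu> \<kappa> \<mu> w = \<rho>"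
    and "is_partition \<nu>" "is_partition \<kappa>" "is_partition \<mu>" "is_partition \<rho>"
  shows "(\<Sum>k. \<rho> k) + (\<Sum>k. \<mu> k) = w + ((\<Sum>k. \<nu> k) + (\<Sum>k. \<kappa> k))"
proof -
  have "\<forall>\<^sub>F K in sequentially. (\<Sum>k. \<rho> k) + (\<Sum>k. \<mu> k) = w + ((\<Sum>k. \<nu> k) + (\<Sum>k. \<kappa> k))"
    using assms(4-7)[THEN is_partition_suminf] assms(4-7)[unfolded is_partition_def, THEN conjunct2]
  proof eventually_elim
    case (elim K)
    show ?case
      using local_rule_sums[OF assms(1,2), of w K] elim unfolding assms(3) by simp
  qed
  then show ?thesis by simp
qed

definition inverse_local_rule ::
    "(nat \<Rightarrow> nat) \<Rightarrow> (nat \<Rightarrow> nat) \<Rightarrow> (nat \<Rightarrow> nat) \<Rightarrow> nat \<Rightarrow> nat" where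
  "inverse_local_rule \<nu> \<kappa> \<rho> k = max (\<nu> (Suc k)) (\<kappa> (Suc k)) + min (\<nu> k) (\<kappa> k) - \<rho> (Suc k)"

lemma inverse_local_rule_interlaces:
  assumes "interlaces \<rho> \<nu>" "interlaces \<rho> \<kappa>"
  shows "interlaces \<nu> (inverse_local_rule \<nu> \<kappa> \<rho>)" "interlaces \<kappa> (inverse_local_rule \<nu> \<kappa> \<rho>)"
proof -
  have "inverse_local_rule \<nu> \<kappa> \<rho> k \<le> \<nu> k \<and> inverse_local_rule \<nu> \<kappa> \<rho> k \<le> \<kappa> k \<and>
      \<nu> (Suc k) \<le> inverse_local_rule \<nu> \<kappa> \<rho> k \<and> \<kappa> (Suc k) \<le> inverse_local_rule \<nu> \<kappa> \<rho> k" for k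
  proof -
    have "\<rho> (Suc k) \<le> \<nu> k" "\<rho> (Suc k) \<le> \<kappa> k" "\<nu> (Suc k) \<le> \<rho> (Suc k)" "\<kappa> (Suc k) \<le> \<rho> (Suc k)"
      using assms by (auto simp: interlaces_def)
    then show ?thesis by (auto simp: inverse_local_rule_def max_def min_def)
  qed
  then show "interlaces \<nu> (inverse_local_rule \<nu> \<kappa> \<rho>)" "interlaces \<kappa> (inverse_local_rule \<nu> \<kappa> \<rho>)"
    by (auto simp: interlaces_def)
qed

text \<open>
  For fixed \<open>\<nu>\<close> and \<open>\<kappa>\<close> the local rule is injective in \<open>(\<mu>,
  w)\<close>: the first part of \<open>\<rho>\<close> determines \<open>w\<close>, and each further part
  determines one part of \<open>\<mu>\<close>.
\<close>

lemma local_rule_eq_iff: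
  assumes "interlaces \<nu> \<mu>" "interlaces \<kappa> \<mu>" "interlaces \<rho> \<nu>" "interlaces \<rho> \<kappa>"
  shows "local_rule \<nu> \<kappa> \<mu> w = \<rho> \<longleftrightarrow>
    \<mu> = inverse_local_rule \<nu> \<kappa> \<rho> \<and> w = \<rho> 0 - max (\<nu> 0) (\<kappa> 0)"
proof -
  have i: "\<mu> k \<le> \<nu> k" "\<mu> k \<le> \<kappa> k" "\<rho> (Suc k) \<le> \<nu> k" "\<rho> (Suc k) \<le> \<kappa> k" "\<nu> k \<le> \<rho> k" "\<kappa> k \<le> \<rho> k" for k
    using assms by (auto simp: interlaces_def)
  have "local_rule \<nu> \<kappa> \<mu> w = \<rho> \<longleftrightarrow>
      local_rule \<nu> \<kappa> \<mu> w 0 = \<rho> 0 \<and> (\<forall>k. local_rule \<nu> \<kappa> \<mu> w (Suc k) = \<rho> (Suc k))"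
    by (metis fun_eq_iff not0_implies_Suc)
  also have "local_rule \<nu> \<kappa> \<mu> w 0 = \<rho> 0 \<longleftrightarrow> w = \<rho> 0 - max (\<nu> 0) (\<kappa> 0)"
    using i[of 0] by (auto simp: local_rule_def)
  also have "(\<forall>k. local_rule \<nu> \<kappa> \<mu> w (Suc k) = \<rho> (Suc k)) \<longleftrightarrow>
      (\<forall>k. \<mu> k = inverse_local_rule \<nu> \<kappa> \<rho> k)"
  proof (intro all_cong1)
    fix k
    show "local_rule \<nu> \<kappa> \<mu> w (Suc k) = \<rho> (Suc k) \<longleftrightarrow> \<mu> k = inverse_local_rule \<nu> \<kappa> \<rho> k"
      using i[of k] i[of "Suc k"] by (auto simp: local_rule_def inverse_local_rule_def max_def min_def)
  qed
  finally show ?thesis by (auto simp: fun_eq_iff)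
qed

fun growth :: "(vertex \<Rightarrow> nat) \<Rightarrow> nat \<Rightarrow> nat \<Rightarrow> nat \<Rightarrow> nat" where
  "growth A 0 n = empty_partition"
| "growth A (Suc m) 0 = empty_partition"
| "growth A (Suc m) (Suc n) =
     local_rule (growth A m (Suc n)) (growth A (Suc m) n) (growth A m n) (A (Suc m, Suc n))"

lemma growth_row_0 [simp]: "growth A m 0 = empty_partition"
  by (cases m) auto

text \<open>
  The shapes at two horizontally or vertically neighbouring vertices interlace. Both statements are proved
  together because the local rule needs both of them at the preceding vertices.
\<close>

lemma growth_interlaces:
  "interlaces (growth A (Suc m) n) (growth A m n)" "interlaces (growth A m (Suc n)) (growth A m n)"
proof (induction "m + n" arbitrary: m n rule: less_induct)
  case less
  have e: "interlaces empty_partition empty_partition"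
    by (simp add: interlaces_def empty_partition_def)
  {
    case 1
    show ?case
      using less(1)[of m "n - 1"] less(2)[of m "n - 1"]
      by (cases n) (auto simp: e intro!: local_rule_interlaces(1))
  next
    case 2
    show ?case
      using less(1)[of "m - 1" n] less(2)[of "m - 1" n]
      by (cases m) (auto simp: e intro!: local_rule_interlaces(2))
  }
qed

text \<open>
  Both sides satisfy the same recurrence with zero boundary values, and the value at \<open>(m, n)\<close>
  occurs in it once.
\<close>

lemma growth_sums: "sum (growth A m n) {..<k} = passage A m n k"
proof (induction "m + n" arbitrary: m n k rule: less_induct)
  case less
  show ?case
  proof (cases "m = 0 \<or> n = 0 \<or> k = 0")
    case True
    then show ?thesis by (auto simp: empty_partition_def)
  next
    case False
    then obtain m' n' k' where eq: "m = Suc m'" "n = Suc n'" "k = Suc k'"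
      by (cases m; cases n; cases k) auto
    have IH: "sum (growth A m' n') {..<j} = passage A m' n' j"
      "sum (growth A m' (Suc n')) {..<j} = passage A m' (Suc n') j"
      "sum (growth A (Suc m') n') {..<j} = passage A (Suc m') n' j" for j
      by (auto intro!: less.hyps simp: eq)
    show ?thesis
      using local_rule_sums[OF growth_interlaces(2)[of A m' n'] growth_interlaces(1)[of A m' n'],
          of "A (Suc m', Suc n')" k'] passage_recurrence[of A m' n' k']
      unfolding IH eq growth.simps(3)[symmetric] by simp
  qed
qed

lemma growth_is_partition: "is_partition (growth A m n)"
proof -
  have "decseq (growth A m n)"
  proof (cases m)
    case 0
    then show ?thesis by (simp add: empty_partition_def decseq_def)
  next
    case (Suc m')
    then show ?thesis
      using growth_interlaces(1)[of A m' n] order_trans unfolding interlaces_def decseq_Suc_iff by blast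
  qed
  moreover have "growth A m n k = 0" if "k \<ge> m" for k
    using that
  proof (induction m arbitrary: k)
    case (Suc m)
    then obtain k' where "k = Suc k'" "m \<le> k'" by (cases k) auto
    then show ?case
      using growth_interlaces(1)[of A m n] Suc.IH[of k'] unfolding interlaces_def by (metis le_zero_eq)
  qed (simp add: empty_partition_def)
  ultimately show ?thesis by (auto simp: is_partition_def eventually_sequentially)
qed

text \<open>
  The increments of last passage times are the partitions generated by the local rule. In particular they are
  natural numbers in weakly decreasing order.
\<close>

theorem shape_eq_growth: "shape (\<lambda>u. real (A u)) v = (\<lambda>k. real (growth A (fst v) (snd v) k))"
proof
  fix k
  obtain m n where v: "v = (m, n)" by (cases v)
  have "passage A m n (Suc k) = passage A m n k + growth A m n k"
    by (simp add: growth_sums[symmetric])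
  then show "shape (\<lambda>u. real (A u)) v k = real (growth A (fst v) (snd v) k)"
    by (auto simp: shape_def v Let_def last_passage_eq_passage empty_partition_def)
qed

lemma growth_cong:
  assumes "\<And>u. u \<in> {1..m} \<times> {1..n} \<Longrightarrow> A u = B u"
  shows "growth A m n = growth B m n"
  using assms
proof (induction A m n rule: growth.induct)
  case (3 A m n)
  have "growth A m (Suc n) = growth B m (Suc n)" "growth A (Suc m) n = growth B (Suc m) n"
    "growth A m n = growth B m n" "A (Suc m, Suc n) = B (Suc m, Suc n)"
    using 3 by auto
  then show ?case by simp
qed auto

section \<open>The law of the shapes along a down-right path\<close>

text \<open>
  An entry is independent of every event that is determined by finitely many other entries. All sets of
  restricted arrays are measurable since there are only countably many of these arrays.
\<close>

lemma (in prob_space) prob_indep_new_entry: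
  fixes W :: "'i \<Rightarrow> 'a \<Rightarrow> nat" and \<Phi> :: "('i \<Rightarrow> nat) \<Rightarrow> bool"
  assumes indep: "indep_vars (\<lambda>_. count_space UNIV) W I"
    and K: "finite K" "K \<subseteq> I" and u: "u \<in> I" "u \<notin> K"
    and \<Phi>: "\<And>f g. (\<And>i. i \<in> K \<Longrightarrow> f i = g i) \<Longrightarrow> \<Phi> f \<longleftrightarrow> \<Phi> g"
  shows "\<P>(\<omega> in M. \<Phi> (\<lambda>i. W i \<omega>) \<and> W u \<omega> = w) = \<P>(\<omega> in M. \<Phi> (\<lambda>i. W i \<omega>)) * \<P>(\<omega> in M. W u \<omega> = w)"
proof -
  let ?N = "\<lambda>_. count_space UNIV :: nat measure"
  have iv: "indep_var (PiM K ?N) (\<lambda>\<omega>. restrict (\<lambda>i. W i \<omega>) K) (PiM {u} ?N) (\<lambda>\<omega>. restrict (\<lambda>i. W i \<omega>) {u})"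
    by (rule indep_var_restrict[OF indep]) (use K u in auto)
  have sets: "sets (PiM K ?N) = Pow (PiE K (\<lambda>_. UNIV))" "sets (PiM {u} ?N) = Pow (PiE {u} (\<lambda>_. UNIV))"
    using K by (simp_all add: count_space_PiM_finite)
  let ?X = "{f \<in> PiE K (\<lambda>_. UNIV). \<Phi> f}" and ?Y = "{f \<in> PiE {u} (\<lambda>_. UNIV). f u = w}"
  have "prob ((\<lambda>\<omega>. (restrict (\<lambda>i. W i \<omega>) K, restrict (\<lambda>i. W i \<omega>) {u})) -` (?X \<times> ?Y) \<inter> space M) =
      prob ((\<lambda>\<omega>. restrict (\<lambda>i. W i \<omega>) K) -` ?X \<inter> space M) *
      prob ((\<lambda>\<omega>. restrict (\<lambda>i. W i \<omega>) {u}) -` ?Y \<inter> space M)"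
    by (rule indep_varD[OF iv]) (auto simp: sets)
  moreover have "\<Phi> (restrict f K) \<longleftrightarrow> \<Phi> f" for f by (rule \<Phi>) simp
  then have "(\<lambda>\<omega>. (restrict (\<lambda>i. W i \<omega>) K, restrict (\<lambda>i. W i \<omega>) {u})) -` (?X \<times> ?Y) \<inter> space M =
      {\<omega> \<in> space M. \<Phi> (\<lambda>i. W i \<omega>) \<and> W u \<omega> = w}"
    "(\<lambda>\<omega>. restrict (\<lambda>i. W i \<omega>) K) -` ?X \<inter> space M = {\<omega> \<in> space M. \<Phi> (\<lambda>i. W i \<omega>)}"
    by auto
  moreover have "(\<lambda>\<omega>. restrict (\<lambda>i. W i \<omega>) {u}) -` ?Y \<inter> space M = {\<omega> \<in> space M. W u \<omega> = w}"
    by auto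
  ultimately show ?thesis by simp
qed

text \<open>
  The factor \<open>Q\<close> of an edge, with the letter of the step read off from its endpoints.
\<close>

definition edge_weight ::
    "(nat \<Rightarrow> real) \<Rightarrow> (nat \<Rightarrow> real) \<Rightarrow> vertex \<Rightarrow> vertex \<Rightarrow> (nat \<Rightarrow> nat) \<Rightarrow> (nat \<Rightarrow> nat) \<Rightarrow> real" where
  "edge_weight x y u v p q =
     (if (fst v, snd v + 1) = u then skew_schur p q (y (snd u)) else skew_schur q p (x (fst u + 1)))"

lemma edge_weight_down [simp]:
  "edge_weight x y (a, Suc b) (a, b) p q = skew_schur p q (y (Suc b))"
  by (simp add: edge_weight_def)

lemma edge_weight_right [simp]:
  "edge_weight x y (a, b) (Suc a, b) p q = skew_schur q p (x (Suc a))"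
  by (simp add: edge_weight_def)

lemma skew_schur_empty [simp]: "skew_schur empty_partition empty_partition z = 1"
  by (simp add: skew_schur_def interlaces_def empty_partition_def)

lemma skew_schur_eq_0: "\<not> interlaces p q \<Longrightarrow> skew_schur p q z = 0"
  by (simp add: skew_schur_def)

lemma interlaces_empty: "interlaces empty_partition q \<Longrightarrow> q = empty_partition"
  by (auto simp: interlaces_def empty_partition_def)

lemma skew_size:
  assumes "interlaces p q" "is_partition p" "is_partition q"
  shows "(\<Sum>k. p k - q k) + (\<Sum>k. q k) = (\<Sum>k. p k)"
proof -
  obtain K where K: "\<And>k. k \<ge> K \<Longrightarrow> p k = 0" "\<And>k. k \<ge> K \<Longrightarrow> q k = 0"
    using assms(2,3) unfolding is_partition_def eventually_sequentially
    by (metis nle_le order_trans)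
  have "(\<Sum>k. p k - q k) = (\<Sum>k<K. p k - q k)" "(\<Sum>k. q k) = (\<Sum>k<K. q k)" "(\<Sum>k. p k) = (\<Sum>k<K. p k)"
    by (rule suminf_finite; simp add: K)+
  then show ?thesis
    using assms(1) by (simp add: sum.distrib[symmetric] interlaces_def)
qed

lemma inverse_local_rule_is_partition:
  assumes "interlaces \<rho> \<nu>" "interlaces \<rho> \<kappa>" "is_partition \<nu>"
  shows "is_partition (inverse_local_rule \<nu> \<kappa> \<rho>)"
proof -
  have i: "inverse_local_rule \<nu> \<kappa> \<rho> k \<le> \<nu> k" "\<nu> (Suc k) \<le> inverse_local_rule \<nu> \<kappa> \<rho> k" for k
    using inverse_local_rule_interlaces(1)[OF assms(1,2)] by (auto simp: interlaces_def)
  have "decseq (inverse_local_rule \<nu> \<kappa> \<rho>)"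
    unfolding decseq_Suc_iff using i order_trans by blast
  moreover have "\<forall>\<^sub>F k in sequentially. inverse_local_rule \<nu> \<kappa> \<rho> k = 0"
    using assms(3)[unfolded is_partition_def, THEN conjunct2]
    by eventually_elim (use i(1) in \<open>metis le_zero_eq\<close>)
  ultimately show ?thesis by (simp add: is_partition_def)
qed

text \<open>
  Both sides are monomials in \<open>a\<close> and \<open>b\<close>, and their exponents agree by
  \<open>local_rule_size\<close>.
\<close>

lemma skew_schur_flip:
  fixes a b :: real
  assumes "interlaces \<rho> \<nu>" "interlaces \<rho> \<kappa>" "is_partition \<nu>" "is_partition \<kappa>" "is_partition \<rho>"
  defines "\<mu> \<equiv> inverse_local_rule \<nu> \<kappa> \<rho>" and "w \<equiv> \<rho> 0 - max (\<nu> 0) (\<kappa> 0)"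
  shows "skew_schur \<rho> \<nu> a * skew_schur \<rho> \<kappa> b = (a * b) ^ w * (skew_schur \<nu> \<mu> b * skew_schur \<kappa> \<mu> a)"
proof -
  have i: "interlaces \<nu> \<mu>" "interlaces \<kappa> \<mu>"
    unfolding \<mu>_def by (rule inverse_local_rule_interlaces[OF assms(1,2)])+
  have \<mu>: "is_partition \<mu>" unfolding \<mu>_def by (rule inverse_local_rule_is_partition[OF assms(1-3)])
  have "local_rule \<nu> \<kappa> \<mu> w = \<rho>"
    using local_rule_eq_iff[OF i assms(1,2)] by (simp add: \<mu>_def w_def)
  then have size: "(\<Sum>k. \<rho> k) + (\<Sum>k. \<mu> k) = w + ((\<Sum>k. \<nu> k) + (\<Sum>k. \<kappa> k))"
    by (intro local_rule_size i assms(3-5) \<mu>)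
  have "(\<Sum>k. \<rho> k - \<nu> k) = w + (\<Sum>k. \<kappa> k - \<mu> k)" "(\<Sum>k. \<rho> k - \<kappa> k) = w + (\<Sum>k. \<nu> k - \<mu> k)"
    using size skew_size[OF assms(1,5,3)] skew_size[OF assms(2,5,4)]
      skew_size[OF i(1) assms(3) \<mu>] skew_size[OF i(2) assms(4) \<mu>] by linarith+
  then show ?thesis
    using assms(1,2) i by (simp add: skew_schur_def power_add power_mult_distrib)
qed

definition lattice_path :: "nat \<Rightarrow> nat \<Rightarrow> (nat \<Rightarrow> vertex) \<Rightarrow> bool" where
  "lattice_path M N v \<longleftrightarrow> v 0 = (0, N) \<and> v (M + N) = (M, 0) \<and>
     (\<forall>i<M + N. v i = (fst (v (Suc i)), Suc (snd (v (Suc i)))) \<or> v (Suc i) = (Suc (fst (v i)), snd (v i)))"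

lemma lattice_path_step:
  assumes "lattice_path M N v" "i < M + N"
  shows "v i = (fst (v (Suc i)), Suc (snd (v (Suc i)))) \<or> v (Suc i) = (Suc (fst (v i)), snd (v i))"
  using assms unfolding lattice_path_def by blast

lemma lattice_path_mono:
  assumes "lattice_path M N v" "i \<le> j" "j \<le> M + N"
  shows "fst (v i) \<le> fst (v j) \<and> snd (v j) \<le> snd (v i)"
  using assms(2,3)
proof (induction j rule: dec_induct)
  case (step j)
  then have "v j = (fst (v (Suc j)), Suc (snd (v (Suc j)))) \<or> v (Suc j) = (Suc (fst (v j)), snd (v j))"
    using assms(1) by (auto simp: lattice_path_def)
  then show ?case using step by (cases "v j"; cases "v (Suc j)") auto
qed simp

definition path_region :: "nat \<Rightarrow> (nat \<Rightarrow> vertex) \<Rightarrow> vertex set" where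
  "path_region L v = {(a, b). a \<ge> 1 \<and> b \<ge> 1 \<and> (\<exists>d. (a + d, b + d) \<in> v ` {..L})}"

lemma mem_path_region:
  "(a, b) \<in> path_region L v \<longleftrightarrow> a \<ge> 1 \<and> b \<ge> 1 \<and> (\<exists>d. \<exists>j\<le>L. v j = (a + d, b + d))"
  unfolding path_region_def image_iff by (simp add: Bex_def) metis

lemma path_region_finite:
  assumes "lattice_path M N v"
  shows "finite (path_region (M + N) v)"
proof (rule finite_subset)
  show "path_region (M + N) v \<subseteq> {..M} \<times> {..N}"
  proof (clarsimp simp: path_region_def)
    fix a b d i assume i: "i \<le> M + N" and v: "(a + d, b + d) = v i"
    have "fst (v i) \<le> M" "snd (v i) \<le> N"
      using lattice_path_mono[OF assms i order_refl] lattice_path_mono[OF assms, of 0 i] i assms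
      by (auto simp: lattice_path_def)
    then show "a \<le> M \<and> b \<le> N" unfolding v[symmetric] by simp
  qed
qed simp

text \<open>
  Without a right step followed by a down step, the path goes down the vertical axis to the origin and then
  along the horizontal axis.
\<close>

lemma lattice_path_without_corner:
  assumes path: "lattice_path M N v"
    and corner: "\<And>i. Suc i < M + N \<Longrightarrow> v (Suc i) = (Suc (fst (v i)), snd (v i)) \<Longrightarrow>
      v (Suc (Suc i)) = (Suc (fst (v (Suc i))), snd (v (Suc i)))"
    and i: "i \<le> M + N"
  shows "fst (v i) = 0 \<or> snd (v i) = 0"
proof -
  have right: "snd (v j) = 0" if "j < M + N" "v (Suc j) = (Suc (fst (v j)), snd (v j))" for j
    using that
  proof (induction "M + N - j" arbitrary: j rule: less_induct)
    case less
    show ?case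
    proof (cases "Suc j = M + N")
      case True
      then have "snd (v (Suc j)) = 0" using path by (simp add: lattice_path_def)
      then show ?thesis using less.prems(2) by simp
    next
      case False
      then have "snd (v (Suc j)) = 0" using less.prems corner[of j] by (intro less.hyps) auto
      then show ?thesis using less.prems(2) by simp
    qed
  qed
  show ?thesis using i
  proof (induction i)
    case 0
    then show ?case using path by (simp add: lattice_path_def)
  next
    case (Suc i)
    then consider "v i = (fst (v (Suc i)), Suc (snd (v (Suc i))))" | "v (Suc i) = (Suc (fst (v i)), snd (v i))"
      using lattice_path_step[OF path, of i] Suc_le_lessD by blast
    then show ?case
    proof cases
      case 1
      then have "fst (v i) = fst (v (Suc i))" "snd (v i) \<noteq> 0" by (metis fst_conv, metis snd_conv nat.distinct(1))
      then show ?thesis using Suc by simp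
    next
      case 2
      then show ?thesis using right[of i] Suc.prems by simp
    qed
  qed
qed

text \<open>
  Interlacing along the edges forces the shapes on the vertical axis to be empty, starting from \<open>lam
  0\<close>, and those on the horizontal axis, starting from the last one.
\<close>

lemma edge_weights_without_corner:
  assumes path: "lattice_path M N v"
    and corner: "\<And>i. Suc i < M + N \<Longrightarrow> v (Suc i) = (Suc (fst (v i)), snd (v i)) \<Longrightarrow>
      v (Suc (Suc i)) = (Suc (fst (v (Suc i))), snd (v (Suc i)))"
    and ends: "lam 0 = empty_partition" "lam (M + N) = empty_partition"
    and nz: "\<And>i. i < M + N \<Longrightarrow> edge_weight x y (v i) (v (Suc i)) (lam i) (lam (Suc i)) \<noteq> 0"
    and i: "i \<le> M + N"
  shows "lam i = empty_partition"
proof -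
  have step_right: "interlaces (lam (Suc j)) (lam j)" if "j < M + N" "v (Suc j) = (Suc (fst (v j)), snd (v j))" for j
    using nz[OF that(1)] that(2) skew_schur_eq_0 by (cases "v j") (auto simp: edge_weight_def)
  have step_down: "interlaces (lam j) (lam (Suc j))" if "j < M + N" "v j = (fst (v (Suc j)), Suc (snd (v (Suc j))))" for j
    using nz[OF that(1)] that(2) skew_schur_eq_0 by (cases "v (Suc j)") (auto simp: edge_weight_def)
  have right: "lam j = empty_partition" if "j < M + N" "v (Suc j) = (Suc (fst (v j)), snd (v j))" for j
    using that
  proof (induction "M + N - j" arbitrary: j rule: less_induct)
    case less
    have "lam (Suc j) = empty_partition"
    proof (cases "Suc j = M + N")
      case True
      then show ?thesis using ends by simp
    next
      case False
      then show ?thesis using less.prems corner[of j] by (intro less.hyps) auto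
    qed
    then show ?case using step_right[OF less.prems] interlaces_empty by simp
  qed
  show ?thesis using i
  proof (induction i)
    case (Suc i)
    then consider "v i = (fst (v (Suc i)), Suc (snd (v (Suc i))))" | "v (Suc i) = (Suc (fst (v i)), snd (v i))"
      using lattice_path_step[OF path, of i] Suc_le_lessD by blast
    then show ?case
    proof cases
      case 1
      then show ?thesis using step_down[of i] Suc interlaces_empty by simp
    next
      case 2
      show ?thesis
      proof (cases "Suc i = M + N")
        case True
        then show ?thesis using ends by simp
      next
        case False
        then show ?thesis using right[of "Suc i"] corner[of i] 2 Suc.prems by simp
      qed
    qed
  qed (use ends in simp)
qed

text \<open>
  Replacing the corner \<open>(a + 1, b + 1)\<close> by \<open>(a, b)\<close> removes exactly the entry at
  \<open>(a + 1, b + 1)\<close> from the region, and no vertex of the new path lies weakly above and to the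
  right of that entry. Hence the shapes along the new path do not depend on it.
\<close>

lemma flip_corner:
  assumes path: "lattice_path M N v" and i: "Suc i < M + N"
    and v: "v i = (a, Suc b)" "v (Suc i) = (Suc a, Suc b)" "v (Suc (Suc i)) = (Suc a, b)"
  defines "v' \<equiv> v(Suc i := (a, b))"
  shows "lattice_path M N v'"
    and "path_region (M + N) v = insert (Suc a, Suc b) (path_region (M + N) v')"
    and "\<And>j. j \<le> M + N \<Longrightarrow> fst (v' j) \<le> M \<and> snd (v' j) \<le> N \<and> \<not> (a < fst (v' j) \<and> b < snd (v' j))"
    and "(Suc a, Suc b) \<notin> path_region (M + N) v'"
proof -
  show path': "lattice_path M N v'"
    unfolding lattice_path_def
  proof (intro conjI allI impI)
    show "v' 0 = (0, N)" "v' (M + N) = (M, 0)" using path i by (auto simp: v'_def lattice_path_def)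
    fix j assume j: "j < M + N"
    consider "j = i" | "j = Suc i" | "j \<noteq> i" "j \<noteq> Suc i" by blast
    then show "v' j = (fst (v' (Suc j)), Suc (snd (v' (Suc j)))) \<or> v' (Suc j) = (Suc (fst (v' j)), snd (v' j))"
    proof cases
      case 3
      then have "v' j = v j" "v' (Suc j) = v (Suc j)" by (auto simp: v'_def)
      then show ?thesis using path j unfolding lattice_path_def by simp
    qed (auto simp: v'_def v)
  qed
  show below: "fst (v' j) \<le> M \<and> snd (v' j) \<le> N \<and> \<not> (a < fst (v' j) \<and> b < snd (v' j))" if j: "j \<le> M + N" for j
  proof -
    have "fst (v' j) \<le> M" "snd (v' j) \<le> N"
      using lattice_path_mono[OF path' j order_refl] lattice_path_mono[OF path', of 0 j] j path'
      by (auto simp: lattice_path_def)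
    moreover have "fst (v' j) \<le> a \<or> snd (v' j) \<le> b"
    proof (cases "j \<le> Suc i")
      case True
      then show ?thesis using lattice_path_mono[OF path' True] i by (simp add: v'_def)
    next
      case False
      then show ?thesis using lattice_path_mono[OF path', of "Suc i" j] j by (simp add: v'_def)
    qed
    ultimately show ?thesis by auto
  qed
  show "(Suc a, Suc b) \<notin> path_region (M + N) v'"
  proof
    assume "(Suc a, Suc b) \<in> path_region (M + N) v'"
    then obtain d j where "j \<le> M + N" "v' j = (Suc a + d, Suc b + d)"
      unfolding mem_path_region by blast
    then show False using below[of j] by simp
  qed
  have "(p, q) \<in> path_region (M + N) v \<longleftrightarrow> (p, q) \<in> insert (Suc a, Suc b) (path_region (M + N) v')" for p q
  proof
    assume "(p, q) \<in> path_region (M + N) v"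
    then obtain d j where u: "p \<ge> 1" "q \<ge> 1" "j \<le> M + N" "v j = (p + d, q + d)"
      unfolding mem_path_region by blast
    show "(p, q) \<in> insert (Suc a, Suc b) (path_region (M + N) v')"
    proof (cases "j = Suc i \<and> d = 0")
      case True
      then show ?thesis using u v by simp
    next
      case False
      then have "v' j = (p + (if j = Suc i then d - 1 else d), q + (if j = Suc i then d - 1 else d))"
        using u v by (auto simp: v'_def)
      then show ?thesis using u unfolding insert_iff mem_path_region by blast
    qed
  next
    assume "(p, q) \<in> insert (Suc a, Suc b) (path_region (M + N) v')"
    then consider "p = Suc a" "q = Suc b" | "(p, q) \<in> path_region (M + N) v'" by blast
    then show "(p, q) \<in> path_region (M + N) v"
    proof cases
      case 1
      then have "v (Suc i) = (p + 0, q + 0)" using v by simp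
      then show ?thesis using i 1 unfolding mem_path_region
        by (metis Suc_leI le_add1 less_imp_le plus_1_eq_Suc)
    next
      case 2
      then obtain d j where u: "p \<ge> 1" "q \<ge> 1" "j \<le> M + N" "v' j = (p + d, q + d)"
        unfolding mem_path_region by blast
      then have "v j = (p + (if j = Suc i then Suc d else d), q + (if j = Suc i then Suc d else d))"
        using v by (auto simp: v'_def split: if_splits)
      then show ?thesis using u unfolding mem_path_region by blast
    qed
  qed
  then show "path_region (M + N) v = insert (Suc a, Suc b) (path_region (M + N) v')"
    by (intro subset_antisym subrelI) blast+
qed

text \<open>
  Induction over corner flips. The event for a path with a corner at \<open>(a + 1, b + 1)\<close> is, by
  injectivity of the local rule, the intersection of one event for the flipped path with the event that the
  entry at the corner has one particular value, and these two events are independent.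
\<close>

theorem (in prob_space) growth_law:
  fixes W :: "vertex \<Rightarrow> 'a \<Rightarrow> nat" and x y :: "nat \<Rightarrow> real"
  assumes indep: "indep_vars (\<lambda>_. count_space UNIV) W ({1..} \<times> {1..})"
    and geometric: "\<And>i j k. i \<ge> 1 \<Longrightarrow> j \<ge> 1 \<Longrightarrow>
      \<P>(\<omega> in M. W (i, j) \<omega> = k) = (x i * y j) ^ k * (1 - x i * y j)"
    and path: "lattice_path m n v"
    and lam: "\<And>i. i \<le> m + n \<Longrightarrow> is_partition (lam i)"
  shows "\<P>(\<omega> in M. \<forall>i\<le>m + n. growth (\<lambda>u. W u \<omega>) (fst (v i)) (snd (v i)) = lam i) =
    (\<Prod>(a, b)\<in>path_region (m + n) v. 1 - x a * y b) *
    of_bool (lam 0 = empty_partition \<and> lam (m + n) = empty_partition) *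
    (\<Prod>i<m + n. edge_weight x y (v i) (v (Suc i)) (lam i) (lam (Suc i)))"
  using path lam
proof (induction "\<Sum>i\<le>m + n. fst (v i) + snd (v i)" arbitrary: v lam rule: less_induct)
  case less
  note path = less.prems(1) and lam = less.prems(2)
  show ?case
  proof (cases "\<exists>i. Suc i < m + n \<and> v (Suc i) = (Suc (fst (v i)), snd (v i)) \<and>
      v (Suc (Suc i)) \<noteq> (Suc (fst (v (Suc i))), snd (v (Suc i)))")
    case False
    then have corner: "v (Suc (Suc i)) = (Suc (fst (v (Suc i))), snd (v (Suc i)))"
      if "Suc i < m + n" "v (Suc i) = (Suc (fst (v i)), snd (v i))" for i
      using that by blast
    have axes: "fst (v i) = 0 \<or> snd (v i) = 0" if "i \<le> m + n" for i
      by (rule lattice_path_without_corner[OF path corner that])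
    have grow: "growth A (fst (v i)) (snd (v i)) = empty_partition" if "i \<le> m + n" for A i
      using axes[OF that] by auto
    have "path_region (m + n) v = {}"
    proof (rule ccontr)
      assume "path_region (m + n) v \<noteq> {}"
      then obtain a b d j where "a \<ge> 1" "b \<ge> 1" "j \<le> m + n" "v j = (a + d, b + d)"
        by (metis all_not_in_conv mem_path_region surj_pair)
      then show False using axes[of j] by simp
    qed
    moreover have "{\<omega> \<in> space M. \<forall>i\<le>m + n. growth (\<lambda>u. W u \<omega>) (fst (v i)) (snd (v i)) = lam i} =
        (if \<forall>i\<le>m + n. lam i = empty_partition then space M else {})"
      using grow by auto
    moreover have "(\<Prod>i<m + n. edge_weight x y (v i) (v (Suc i)) (lam i) (lam (Suc i))) = 1"
      if "\<forall>i\<le>m + n. lam i = empty_partition"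
      using that by (intro prod.neutral) (auto simp: edge_weight_def)
    moreover have "(\<Prod>i<m + n. edge_weight x y (v i) (v (Suc i)) (lam i) (lam (Suc i))) = 0"
      if "lam 0 = empty_partition" "lam (m + n) = empty_partition" "\<not> (\<forall>i\<le>m + n. lam i = empty_partition)"
      using edge_weights_without_corner[OF path corner that(1,2), of x y] that(3)
      by (meson finite_lessThan lessThan_iff prod_zero_iff)
    ultimately show ?thesis by (auto simp: prob_space)
  next
    case True
    then obtain i where i: "Suc i < m + n" "v (Suc i) = (Suc (fst (v i)), snd (v i))"
      and down: "v (Suc i) = (fst (v (Suc (Suc i))), Suc (snd (v (Suc (Suc i)))))"
      using lattice_path_step[OF path] by blast
    obtain a b where v: "v i = (a, Suc b)" "v (Suc i) = (Suc a, Suc b)" "v (Suc (Suc i)) = (Suc a, b)"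
      using i(2) down by (cases "v i"; cases "v (Suc (Suc i))") auto
    define v' where "v' = v(Suc i := (a, b))"
    note flip = flip_corner[OF path i(1) v, folded v'_def]
    define \<nu> \<rho> \<kappa> where "\<nu> = lam i" and "\<rho> = lam (Suc i)" and "\<kappa> = lam (Suc (Suc i))"
    define \<mu> where "\<mu> = inverse_local_rule \<nu> \<kappa> \<rho>"
    define w where "w = \<rho> 0 - max (\<nu> 0) (\<kappa> 0)"
    define lam' where "lam' = lam(Suc i := \<mu>)"
    define rest where "rest = {..<m + n} - {i, Suc i}"
    define G where "G = (\<Prod>j\<in>rest. edge_weight x y (v j) (v (Suc j)) (lam j) (lam (Suc j)))"
    have split: "{..<m + n} = insert i (insert (Suc i) rest)" "finite rest" "i \<notin> rest" "Suc i \<notin> rest"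
      using i(1) by (auto simp: rest_def)
    have prod_v: "(\<Prod>j<m + n. edge_weight x y (v j) (v (Suc j)) (lam j) (lam (Suc j))) =
        skew_schur \<rho> \<nu> (x (Suc a)) * skew_schur \<rho> \<kappa> (y (Suc b)) * G"
      unfolding split(1) using split(2-) by (simp add: G_def v \<nu>_def \<rho>_def \<kappa>_def)
    have "(\<Prod>j\<in>rest. edge_weight x y (v' j) (v' (Suc j)) (lam' j) (lam' (Suc j))) = G"
      unfolding G_def by (intro prod.cong) (auto simp: rest_def v'_def lam'_def)
    then have prod_v': "(\<Prod>j<m + n. edge_weight x y (v' j) (v' (Suc j)) (lam' j) (lam' (Suc j))) =
        skew_schur \<nu> \<mu> (y (Suc b)) * skew_schur \<kappa> \<mu> (x (Suc a)) * G"
      unfolding split(1) using split(2-) by (simp add: v'_def v lam'_def \<nu>_def \<kappa>_def)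
    let ?E = "\<lambda>v lam A. \<forall>j\<le>m + n. growth A (fst (v j)) (snd (v j)) = lam j"
    have step: "growth A (Suc a) (Suc b) =
        local_rule (growth A a (Suc b)) (growth A (Suc a) b) (growth A a b) (A (Suc a, Suc b))" for A
      by simp
    show ?thesis
    proof (cases "interlaces \<rho> \<nu> \<and> interlaces \<rho> \<kappa>")
      case False
      \<comment> \<open>Neighbouring shapes always interlace, so the event is impossible and a factor on the right vanishes.\<close>
      have "\<not> ?E v lam A" for A
      proof
        assume "?E v lam A"
        then have "growth A a (Suc b) = \<nu>" "growth A (Suc a) (Suc b) = \<rho>" "growth A (Suc a) b = \<kappa>"
          using i(1) v unfolding \<nu>_def \<rho>_def \<kappa>_def by (metis Suc_leI fst_conv less_imp_le_nat snd_conv Suc_lessD)+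
        then show False using False growth_interlaces(1)[of A a "Suc b"] growth_interlaces(2)[of A "Suc a" b] by simp
      qed
      then have "{\<omega> \<in> space M. ?E v lam (\<lambda>u. W u \<omega>)} = {}" by blast
      then have "\<P>(\<omega> in M. ?E v lam (\<lambda>u. W u \<omega>)) = 0" by (simp only: measure_empty)
      moreover have "skew_schur \<rho> \<nu> (x (Suc a)) * skew_schur \<rho> \<kappa> (y (Suc b)) = 0"
        using False by (auto simp: skew_schur_eq_0)
      ultimately show ?thesis unfolding prod_v by simp
    next
      case True
      have part: "is_partition \<nu>" "is_partition \<kappa>" "is_partition \<rho>"
        using lam i(1) by (auto simp: \<nu>_def \<rho>_def \<kappa>_def)
      have part': "is_partition (lam' j)" if "j \<le> m + n" for j
        using lam[OF that] inverse_local_rule_is_partition[of \<rho> \<nu> \<kappa>] True part(1) by (simp add: lam'_def \<mu>_def)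
      \<comment> \<open>Given its neighbours, the shape at the corner is \<open>\<rho>\<close> iff the opposite shape is \<open>\<mu>\<close> and the entry is \<open>w\<close>.\<close>
      have event: "?E v lam A \<longleftrightarrow> ?E v' lam' A \<and> A (Suc a, Suc b) = w" for A
      proof -
        let ?R = "\<forall>j\<le>m + n. j \<noteq> Suc i \<longrightarrow> growth A (fst (v j)) (snd (v j)) = lam j"
        have 1: "?E v lam A \<longleftrightarrow> ?R \<and> growth A (Suc a) (Suc b) = \<rho>"
          using i(1) v(2) unfolding \<rho>_def by (metis Suc_leI Suc_lessD fst_conv less_imp_le_nat snd_conv)
        have 2: "?E v' lam' A \<longleftrightarrow> ?R \<and> growth A a b = \<mu>"
          using i(1) unfolding v'_def lam'_def by (auto simp del: growth.simps)
        have 3: "growth A a (Suc b) = \<nu> \<and> growth A (Suc a) b = \<kappa>" if ?R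
          using that[rule_format, of i] that[rule_format, of "Suc (Suc i)"] i(1) v by (simp add: \<nu>_def \<kappa>_def)
        have 4: "growth A (Suc a) (Suc b) = \<rho> \<longleftrightarrow> growth A a b = \<mu> \<and> A (Suc a, Suc b) = w" if ?R
          using local_rule_eq_iff[of "growth A a (Suc b)" "growth A a b" "growth A (Suc a) b" \<rho> "A (Suc a, Suc b)"]
            growth_interlaces[of A a b] 3[OF that] True unfolding step \<mu>_def w_def by simp
        show ?thesis using 1 2 4 by blast
      qed
      have "\<P>(\<omega> in M. ?E v lam (\<lambda>u. W u \<omega>)) =
          \<P>(\<omega> in M. ?E v' lam' (\<lambda>u. W u \<omega>) \<and> W (Suc a, Suc b) \<omega> = w)"
        using event by simp
      also have "\<dots> = \<P>(\<omega> in M. ?E v' lam' (\<lambda>u. W u \<omega>)) * \<P>(\<omega> in M. W (Suc a, Suc b) \<omega> = w)"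
      proof (rule prob_indep_new_entry[OF indep, of "{1..m} \<times> {1..n} - {(Suc a, Suc b)}"])
        fix A B :: "vertex \<Rightarrow> nat"
        assume AB: "\<And>u. u \<in> {1..m} \<times> {1..n} - {(Suc a, Suc b)} \<Longrightarrow> A u = B u"
        have "growth A (fst (v' j)) (snd (v' j)) = growth B (fst (v' j)) (snd (v' j))" if "j \<le> m + n" for j
          using flip(3)[OF that] by (intro growth_cong AB) auto
        then show "?E v' lam' A \<longleftrightarrow> ?E v' lam' B" by simp
      qed auto
      also have "\<P>(\<omega> in M. ?E v' lam' (\<lambda>u. W u \<omega>)) =
          (\<Prod>(a, b)\<in>path_region (m + n) v'. 1 - x a * y b) *
          of_bool (lam' 0 = empty_partition \<and> lam' (m + n) = empty_partition) *
          (\<Prod>j<m + n. edge_weight x y (v' j) (v' (Suc j)) (lam' j) (lam' (Suc j)))"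
      proof (rule less.hyps[OF _ flip(1) part'])
        show "(\<Sum>j\<le>m + n. fst (v' j) + snd (v' j)) < (\<Sum>j\<le>m + n. fst (v j) + snd (v j))"
          using i(1) v by (intro sum_strict_mono_ex1) (auto simp: v'_def intro!: bexI[of _ "Suc i"])
      qed
      also have "\<P>(\<omega> in M. W (Suc a, Suc b) \<omega> = w) = (x (Suc a) * y (Suc b)) ^ w * (1 - x (Suc a) * y (Suc b))"
        by (rule geometric) auto
      also have "lam' 0 = lam 0" by (simp add: lam'_def)
      also have "lam' (m + n) = lam (m + n)" using i(1) by (simp add: lam'_def)
      finally show ?thesis
        unfolding prod_v prod_v' flip(2)
        using flip(4) path_region_finite[OF flip(1)] skew_schur_flip[of \<rho> \<nu> \<kappa> "x (Suc a)" "y (Suc b)"] True part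
        by (simp add: \<mu>_def w_def mult_ac)
    qed
  qed
qed

theorem theorem2p4:
  fixes P :: "'a measure"
    and W :: "vertex \<Rightarrow> 'a \<Rightarrow> nat"
    and x y :: "nat \<Rightarrow> real"
    and M N :: nat
    and \<gamma> :: "vertex list"
    and lam :: "nat \<Rightarrow> nat \<Rightarrow> nat"
  assumes "prob_space P"
    and "\<forall>i\<ge>1. x i \<ge> 0"
    and "\<forall>j\<ge>1. y j \<ge> 0"
    and "\<forall>i\<ge>1. \<forall>j\<ge>1. x i * y j \<in> {0..<1}"
    and "prob_space.indep_vars P (\<lambda>_. count_space UNIV) W ({1..} \<times> {1..})"
    and "\<forall>i\<ge>1. \<forall>j\<ge>1. \<forall>k. \<P>(\<omega> in P. W (i, j) \<omega> = k) = (x i * y j) ^ k * (1 - x i * y j)"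
    and "down_right_path \<gamma>"
    and "length \<gamma> = M + N + 1"
    and "\<gamma> ! 0 = (0, N)"
    and "\<gamma> ! (M + N) = (M, 0)"
    and "\<forall>i\<le>M + N. is_partition (lam i)"
  shows "(\<forall>\<omega>\<in>space P. \<forall>v. \<exists>p. is_partition p \<and>
            shape (\<lambda>u. real (W u \<omega>)) v = (\<lambda>k. real (p k))) \<and>
         \<P>(\<omega> in P. \<forall>i\<le>M + N. shape (\<lambda>u. real (W u \<omega>)) (\<gamma> ! i) = (\<lambda>k. real (lam i k))) =
           (\<Prod>(a, b)\<in>region \<gamma>. 1 - x a * y b) *
           of_bool (lam 0 = empty_partition \<and> lam (M + N) = empty_partition) *
           (\<Prod>i=1..M + N.
              step_weight x y (\<gamma> ! (i - 1)) (path_word \<gamma> ! (i - 1)) (lam (i - 1)) (lam i))"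
proof -
  have "prob_space P" by fact
  then interpret prob_space P .
  define v where "v i = \<gamma> ! i" for i
  have step: "(fst (\<gamma> ! Suc i), snd (\<gamma> ! Suc i) + 1) = \<gamma> ! i \<or> \<gamma> ! Suc i = (fst (\<gamma> ! i) + 1, snd (\<gamma> ! i))"
    if "i < M + N" for i
    using assms(7) that assms(8) by (auto simp: down_right_path_def successively_conv_nth)
  have path: "lattice_path M N v"
    unfolding lattice_path_def v_def using assms(9,10) step by (metis Suc_eq_plus1)
  have word: "path_word \<gamma> ! i =
      (if (fst (\<gamma> ! Suc i), snd (\<gamma> ! Suc i) + 1) = \<gamma> ! i then Down else Right)" if "i < M + N" for i
    using that assms(8) by (simp add: path_word_def nth_tl)
  have region: "region \<gamma> = path_region (M + N) v"
  proof -
    have "set \<gamma> = v ` {..M + N}"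
      using assms(8) by (auto simp: set_conv_nth v_def less_Suc_eq_le)
    then show ?thesis by (simp add: region_def path_region_def)
  qed
  have weights: "(\<Prod>i=1..M + N. step_weight x y (\<gamma> ! (i - 1)) (path_word \<gamma> ! (i - 1)) (lam (i - 1)) (lam i)) =
      (\<Prod>i<M + N. edge_weight x y (v i) (v (Suc i)) (lam i) (lam (Suc i)))"
    unfolding One_nat_def prod.atLeast1_atMost_eq
    by (intro prod.cong refl) (auto simp: word step_weight_def edge_weight_def v_def)
  have "\<exists>p. is_partition p \<and> shape (\<lambda>u. real (W u \<omega>)) u = (\<lambda>k. real (p k))" for \<omega> u
    unfolding shape_eq_growth using growth_is_partition by blast
  moreover have "shape (\<lambda>u. real (W u \<omega>)) (\<gamma> ! i) = (\<lambda>k. real (lam i k)) \<longleftrightarrow>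
      growth (\<lambda>u. W u \<omega>) (fst (v i)) (snd (v i)) = lam i" for \<omega> i
    unfolding shape_eq_growth v_def by (auto simp: fun_eq_iff)
  moreover have "\<P>(\<omega> in P. \<forall>i\<le>M + N. growth (\<lambda>u. W u \<omega>) (fst (v i)) (snd (v i)) = lam i) =
      (\<Prod>(a, b)\<in>path_region (M + N) v. 1 - x a * y b) *
      of_bool (lam 0 = empty_partition \<and> lam (M + N) = empty_partition) *
      (\<Prod>i<M + N. edge_weight x y (v i) (v (Suc i)) (lam i) (lam (Suc i)))"
    by (rule growth_law) (use assms(5,6,11) path in auto)
  ultimately show ?thesis unfolding region weights by simp
qed

end
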